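(* Let $r,N\ge1$, let $\lambda=(\lambda_1\ge\dots\ge\lambda_r\ge0)$ be a partition with $\lambda_1<N$, $\mathbf z=(z_1,\dots,z_r)$, and let $w_3,w_4\in S_r$ be arbitrary. Then $$Z\big(\mathcal S^{\mathrm{uncol}}_\lambda(\mathbf z)\big)=\sum_{w_1\in S_r}\sum_{w_2\in S_r}\tilde Z\big(\mathcal S(\lambda,w_1,w_2,w_3,w_4,\mathbf z)\big),$$ where $\tilde Z(\mathfrak S)=\Big(\prod_{i=1}^rz_i^{N(1-r)}\Big)Z(\mathfrak S)$ is the scaled partition function of a bicolored system $\mathfrak S$.
   Context: Colors are $\mathbf c=\{c_1<\dots<c_r\}$, dolors are $\mathbf d=\{d_1<\dots<d_r\}$; $w_0\in S_r$ is the long element; $t$ is a global parameter. The partition function $Z$ of a system is the sum over its states of the product of the weights of all (fused) vertices. Bicolored weights. An unfused vertex carries a color-dolor label $(c,d)$ and a parameter $z$. Its left and right (horizontal) edges each carry one element of $\mathbf c\cup\mathbf d$; its top and bottom edges each carry a number in $\mathbb N=\{0,1,2,\dots\}$. The admissible configurations and weights are: (1) left $=$ right $=x$ a dolor, top $=$ bottom $=n$: weight $1$ if $x=d$; if $x\ne d$, weight $z^{\epsilon}t^{\eta}$ with $\epsilon=1$ if $c=c_1$, else $0$, and $\eta=n$ if $x<d$, else $0$. (2) left $=$ right $=a$ a color, top $=$ bottom $=n$: weight $z$ if $a=c$; $t^n$ if $c>a$; $1$ if $c<a$. (3) left $=d$, right $=c$, top $=n\ge1$, bottom $=n-1$: weight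 $(1-t^n)/(1-t)=1+t+\dots+t^{n-1}$. (4) left $=c$, right $=d$, top $=n$, bottom $=n+1$: weight $(1-t)z$. All other configurations are inadmissible (weight $0$). Order pairs by: $(c,d)<(c',d')$ iff $d>d'$, or $d=d'$ and $c<c'$. A fused vertex is a horizontal row of $r^2$ unfused vertices with the same parameter, one for each pair $(c,d)$, placed left to right in increasing order; vertical edges carry multiplicities in $\mathbb N^{\mathbf c\times\mathbf d}$. It is admissible if its internal horizontal edges can be labelled (then uniquely) so that all unfused vertices are admissible; its weight is the product of the unfused weights. Bicolored systems. $\mathcal S(\lambda,w_1,w_2,w_3,w_4,\mathbf z)$: grid of fused vertices with $r$ rows ($1,\dots,r$ top to bottom, row $i$ having parameter $z_i$) and $N$ columns ($N-1,\dots,0$ left to right). Right boundary of row $i$: color $c_{w_1^{-1}(i)}$; left boundary of row $i$: dolor $d_{w_2^{-1}(i)}$; top boundary: for each $i$ one boson $(c_{w_3^{-1}(i)},d_{w_4^{-1}w_0(i)})$ in column $\lambda_i$ and nothing else; bottom boundary empty. A state assigns spins to all edges, compatibly with the boundary, so that all fused vertices are admissible. Uncolored model. Horizontal spins are in $\{+,-\}$, vertical spins in $\mathbb N$. Vertex weights with parameter $z$: left $=$ right $=+$, top $=$ bottom $=n$: $1$; left $=$ right $=-$, top $=$ bottom $=n$: $z$; left $=+$, right $=-$, top $=n\ge1$, bottom $=n-1$: $(1-t^n)/(1-t)$; left $=-$, right $=+$, top $=n$, bottom $=n+1$: $(1-t)z$; all others $0$. (This is the bicolored model with one color, renamed $-$,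 and one dolor, renamed $+$.) $\mathcal S^{\mathrm{uncol}}_\lambda(\mathbf z)$: same $r\times N$ grid with row parameters $z_i$; left boundary edges all $+$; right boundary edges all $-$; the top boundary edge in column $k$ carries $\#\{i:\lambda_i=k\}$; bottom boundary edges all $0$. *)

theory Defs
  imports Complex_Main "HOL-Library.FuncSet" "HOL-Combinatorics.Permutations"
begin

section \<open>Lattice models on a rectangular grid\<close>

text \<open>
  Rows are numbered 1, ..., r from top to bottom and columns N - 1, ..., 0 from left to right.
  In a state \<open>(H, V)\<close>, the vertex in row i and column k has left edge \<open>H (i, Suc k)\<close>, upper edge
  \<open>V (i - 1, k)\<close>, right edge \<open>H (i, k)\<close> and lower edge \<open>V (i, k)\<close>. Thus \<open>H (i, N)\<close> and \<open>H (i, 0)\<close>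
  are the left and right boundary edges of row i, and \<open>V (0, k)\<close> and \<open>V (r, k)\<close> are the upper and
  lower boundary edges of column k. Admissibility predicates and weights take the spins in the
  order left, upper, right, lower. States are extensional functions, so that each assignment of
  spins to the edges of the grid is counted once.
\<close>

definition lattice_states ::
  "nat \<Rightarrow> nat \<Rightarrow> 'h set \<Rightarrow> 'v set \<Rightarrow> ('h \<Rightarrow> 'v \<Rightarrow> 'h \<Rightarrow> 'v \<Rightarrow> bool) \<Rightarrow>
   (nat \<Rightarrow> 'h) \<Rightarrow> (nat \<Rightarrow> 'h) \<Rightarrow> (nat \<Rightarrow> 'v) \<Rightarrow> (nat \<Rightarrow> 'v) \<Rightarrow>
   ((nat \<times> nat \<Rightarrow> 'h) \<times> (nat \<times> nat \<Rightarrow> 'v)) set"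
where
  "lattice_states r N hs vs adm left right upper lower =
    {(H, V). H \<in> {1..r} \<times> {..N} \<rightarrow>\<^sub>E hs \<and> V \<in> {..r} \<times> {..<N} \<rightarrow>\<^sub>E vs \<and>
       (\<forall>i\<in>{1..r}. H (i, N) = left i \<and> H (i, 0) = right i) \<and>
       (\<forall>k<N. V (0, k) = upper k \<and> V (r, k) = lower k) \<and>
       (\<forall>i\<in>{1..r}. \<forall>k<N. adm (H (i, Suc k)) (V (i - 1, k)) (H (i, k)) (V (i, k)))}"

definition partition_function ::
  "nat \<Rightarrow> nat \<Rightarrow> ('a::comm_ring_1 \<Rightarrow> 'h \<Rightarrow> 'v \<Rightarrow> 'h \<Rightarrow> 'v \<Rightarrow> 'a) \<Rightarrow> (nat \<Rightarrow> 'a) \<Rightarrow>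
   ((nat \<times> nat \<Rightarrow> 'h) \<times> (nat \<times> nat \<Rightarrow> 'v)) set \<Rightarrow> 'a"
where
  "partition_function r N wt z S =
    (\<Sum>(H, V)\<in>S. \<Prod>i\<in>{1..r}. \<Prod>k<N. wt (z i) (H (i, Suc k)) (V (i - 1, k)) (H (i, k)) (V (i, k)))"

text \<open>The polynomial \<open>1 + t + ... + t ^ (n - 1)\<close>, equal to \<open>(1 - t ^ n) / (1 - t)\<close> if \<open>t \<noteq> 1\<close>.\<close>

definition t_number :: "'a::comm_ring_1 \<Rightarrow> nat \<Rightarrow> 'a" where
  "t_number t n = (\<Sum>j<n. t ^ j)"


section \<open>Bicolored model\<close>

text \<open>\<open>Color i\<close> and \<open>Dolor i\<close>, for i in \<open>{1..r}\<close>, stand for the i-th color and the i-th dolor.\<close>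

datatype hspin = Color nat | Dolor nat

definition hspins :: "nat \<Rightarrow> hspin set" where
  "hspins r = Color ` {1..r} \<union> Dolor ` {1..r}"

definition unfused_adm :: "nat \<Rightarrow> nat \<Rightarrow> hspin \<Rightarrow> nat \<Rightarrow> hspin \<Rightarrow> nat \<Rightarrow> bool" where
  "unfused_adm c d left upper right lower =
    (left = right \<and> upper = lower \<or>
     left = Dolor d \<and> right = Color c \<and> upper \<ge> 1 \<and> lower = upper - 1 \<or>
     left = Color c \<and> right = Dolor d \<and> lower = upper + 1)"

definition unfused_weight ::
  "'a::comm_ring_1 \<Rightarrow> nat \<Rightarrow> nat \<Rightarrow> 'a \<Rightarrow> hspin \<Rightarrow> nat \<Rightarrow> hspin \<Rightarrow> nat \<Rightarrow> 'a"
where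
  "unfused_weight t c d z left upper right lower =
    (if unfused_adm c d left upper right lower then
       (case (left, right) of
          (Dolor x, Dolor _) \<Rightarrow>
            if x = d then 1
            else z ^ (if c = 1 then 1 else 0) * t ^ (if x < d then upper else 0)
        | (Color a, Color _) \<Rightarrow> if a = c then z else if c > a then t ^ upper else 1
        | (Dolor _, Color _) \<Rightarrow> t_number t upper
        | (Color _, Dolor _) \<Rightarrow> (1 - t) * z)
     else 0)"

text \<open>The pairs (color, dolor) labelling the unfused vertices of a fused vertex, from left to right.\<close>

definition label_less :: "nat \<times> nat \<Rightarrow> nat \<times> nat \<Rightarrow> bool" where
  "label_less p q = (snd p > snd q \<or> snd p = snd q \<and> fst p < fst q)"

definition labels :: "nat \<Rightarrow> (nat \<times> nat) list" where
  "labels r = [(c, d). d \<leftarrow> rev [1..<Suc r], c \<leftarrow> [1..<Suc r]]"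

lemma set_labels: "set (labels r) = {1..r} \<times> {1..r}"
  by (force simp: labels_def simp del: upt_Suc)

lemma sorted_labels: "sorted_wrt label_less (labels r)"
proof -
  define row where "row = (\<lambda>d::nat. map (\<lambda>c. (c, d)) [1..<Suc r])"
  have set_row: "snd p = d" if "p \<in> set (row d)" for p d
    using that
    by (auto simp: row_def)
  have row: "sorted_wrt label_less (row d)" for d
    unfolding row_def sorted_wrt_map
    by (rule sorted_wrt_mono_rel[OF _ sorted_wrt_upt]) (simp add: label_less_def)
  have "sorted_wrt label_less (concat (map row (rev [1..<Suc m])))" for m
  proof (induction m)
    case 0
    show ?case by simp
  next
    case (Suc m)
    have "concat (map row (rev [1..<Suc (Suc m)])) = row (Suc m) @ concat (map row (rev [1..<Suc m]))"
      by simp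
    moreover have "label_less p q"
      if p: "p \<in> set (row (Suc m))" and q: "q \<in> set (concat (map row (rev [1..<Suc m])))" for p q
    proof -
      obtain d where "d \<in> {1..<Suc m}" "q \<in> set (row d)"
        using q by (auto simp del: upt_Suc)
      then show ?thesis
        using p set_row[of p] set_row[of q] by (auto simp: label_less_def)
    qed
    ultimately show ?case
      using Suc row by (simp only: sorted_wrt_append) blast
  qed
  moreover have "labels r = concat (map row (rev [1..<Suc r]))"
    by (simp only: labels_def row_def)
  ultimately show ?thesis by metis
qed

lemma length_labels: "length (labels r) = r ^ 2"
  by (simp add: labels_def length_concat comp_def sum_list_triv power2_eq_square del: upt_Suc)

text \<open>
  Labellings \<open>h 0, ..., h (r ^ 2)\<close> of the horizontal edges inside a fused vertex, with boundary
  spins \<open>h 0 = left\<close> and \<open>h (r ^ 2) = right\<close>, that make all unfused vertices admissible.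
\<close>

definition fused_labellings ::
  "nat \<Rightarrow> hspin \<Rightarrow> (nat \<times> nat \<Rightarrow> nat) \<Rightarrow> hspin \<Rightarrow> (nat \<times> nat \<Rightarrow> nat) \<Rightarrow> (nat \<Rightarrow> hspin) set"
where
  "fused_labellings r left upper right lower =
    {h \<in> {..r ^ 2} \<rightarrow>\<^sub>E hspins r. h 0 = left \<and> h (r ^ 2) = right \<and>
       (\<forall>k<r ^ 2. case labels r ! k of (c, d) \<Rightarrow>
          unfused_adm c d (h k) (upper (c, d)) (h (Suc k)) (lower (c, d)))}"

lemma fused_labellings_unique:
  assumes "h \<in> fused_labellings r left upper right lower"
    and "h' \<in> fused_labellings r left upper right lower"
  shows "h = h'"
proof -
  have "h k = h' k" if "k \<le> r ^ 2" for k
    using that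
  proof (induction k)
    case 0
    then show ?case using assms by (simp add: fused_labellings_def)
  next
    case (Suc k)
    obtain c d where cd: "labels r ! k = (c, d)" by fastforce
    have k: "k < r ^ 2" using Suc.prems by simp
    have adm: "unfused_adm c d (g k) (upper (c, d)) (g (Suc k)) (lower (c, d))"
      if "g \<in> fused_labellings r left upper right lower" for g
    proof -
      have "\<forall>k<r ^ 2. case labels r ! k of (c, d) \<Rightarrow>
          unfused_adm c d (g k) (upper (c, d)) (g (Suc k)) (lower (c, d))"
        using that unfolding fused_labellings_def mem_Collect_eq by (elim conjE)
      from this[rule_format, OF k]
      show ?thesis by (simp only: cd prod.case)
    qed
    note adm[OF assms(1)] adm[OF assms(2)]
    moreover have "h k = h' k" using Suc by simp
    ultimately show ?case by (auto simp: unfused_adm_def)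
  qed
  moreover have "h \<in> extensional {..r ^ 2}" "h' \<in> extensional {..r ^ 2}"
    using assms by (auto simp: fused_labellings_def PiE_def)
  ultimately show ?thesis by (auto intro: extensionalityI)
qed

definition fused_adm ::
  "nat \<Rightarrow> hspin \<Rightarrow> (nat \<times> nat \<Rightarrow> nat) \<Rightarrow> hspin \<Rightarrow> (nat \<times> nat \<Rightarrow> nat) \<Rightarrow> bool"
where
  "fused_adm r left upper right lower \<longleftrightarrow> fused_labellings r left upper right lower \<noteq> {}"

definition fused_weight ::
  "nat \<Rightarrow> 'a::comm_ring_1 \<Rightarrow> 'a \<Rightarrow>
   hspin \<Rightarrow> (nat \<times> nat \<Rightarrow> nat) \<Rightarrow> hspin \<Rightarrow> (nat \<times> nat \<Rightarrow> nat) \<Rightarrow> 'a"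
where
  "fused_weight r t z left upper right lower =
    (if fused_adm r left upper right lower then
       (let h = (THE h. h \<in> fused_labellings r left upper right lower)
        in \<Prod>k<r ^ 2. case labels r ! k of (c, d) \<Rightarrow>
             unfused_weight t c d z (h k) (upper (c, d)) (h (Suc k)) (lower (c, d)))
     else 0)"

definition long_element :: "nat \<Rightarrow> nat \<Rightarrow> nat" where
  "long_element r i = (if i \<in> {1..r} then r + 1 - i else i)"

definition bicol_top ::
  "nat \<Rightarrow> (nat \<Rightarrow> nat) \<Rightarrow> (nat \<Rightarrow> nat) \<Rightarrow> (nat \<Rightarrow> nat) \<Rightarrow> nat \<Rightarrow> nat \<times> nat \<Rightarrow> nat"
where
  "bicol_top r lam w3 w4 k =
    (\<lambda>p\<in>{1..r} \<times> {1..r}.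
       card {i \<in> {1..r}. lam i = k \<and> p = (inv w3 i, (inv w4 \<circ> long_element r) i)})"

definition bicol_states ::
  "nat \<Rightarrow> nat \<Rightarrow> (nat \<Rightarrow> nat) \<Rightarrow>
   (nat \<Rightarrow> nat) \<Rightarrow> (nat \<Rightarrow> nat) \<Rightarrow> (nat \<Rightarrow> nat) \<Rightarrow> (nat \<Rightarrow> nat) \<Rightarrow>
   ((nat \<times> nat \<Rightarrow> hspin) \<times> (nat \<times> nat \<Rightarrow> nat \<times> nat \<Rightarrow> nat)) set"
where
  "bicol_states r N lam w1 w2 w3 w4 =
    lattice_states r N (hspins r) ({1..r} \<times> {1..r} \<rightarrow>\<^sub>E UNIV) (fused_adm r)
      (\<lambda>i. Dolor (inv w2 i)) (\<lambda>i. Color (inv w1 i))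
      (bicol_top r lam w3 w4) (\<lambda>k. \<lambda>p\<in>{1..r} \<times> {1..r}. 0)"

definition Z_bicol ::
  "nat \<Rightarrow> nat \<Rightarrow> 'a::comm_ring_1 \<Rightarrow> (nat \<Rightarrow> nat) \<Rightarrow>
   (nat \<Rightarrow> nat) \<Rightarrow> (nat \<Rightarrow> nat) \<Rightarrow> (nat \<Rightarrow> nat) \<Rightarrow> (nat \<Rightarrow> nat) \<Rightarrow> (nat \<Rightarrow> 'a) \<Rightarrow> 'a"
where
  "Z_bicol r N t lam w1 w2 w3 w4 z =
    partition_function r N (fused_weight r t) z (bicol_states r N lam w1 w2 w3 w4)"

definition scaled_Z_bicol ::
  "nat \<Rightarrow> nat \<Rightarrow> 'a::field \<Rightarrow> (nat \<Rightarrow> nat) \<Rightarrow>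
   (nat \<Rightarrow> nat) \<Rightarrow> (nat \<Rightarrow> nat) \<Rightarrow> (nat \<Rightarrow> nat) \<Rightarrow> (nat \<Rightarrow> nat) \<Rightarrow> (nat \<Rightarrow> 'a) \<Rightarrow> 'a"
where
  "scaled_Z_bicol r N t lam w1 w2 w3 w4 z =
    (\<Prod>i\<in>{1..r}. z i powi (int N * (1 - int r))) * Z_bicol r N t lam w1 w2 w3 w4 z"


section \<open>Uncolored model\<close>

datatype sign = Plus | Minus

definition uncol_adm :: "sign \<Rightarrow> nat \<Rightarrow> sign \<Rightarrow> nat \<Rightarrow> bool" where
  "uncol_adm left upper right lower =
    (left = right \<and> upper = lower \<or>
     left = Plus \<and> right = Minus \<and> upper \<ge> 1 \<and> lower = upper - 1 \<or>
     left = Minus \<and> right = Plus \<and> lower = upper + 1)"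

definition uncol_weight ::
  "'a::comm_ring_1 \<Rightarrow> 'a \<Rightarrow> sign \<Rightarrow> nat \<Rightarrow> sign \<Rightarrow> nat \<Rightarrow> 'a"
where
  "uncol_weight t z left upper right lower =
    (if uncol_adm left upper right lower then
       (case (left, right) of
          (Plus, Plus) \<Rightarrow> 1
        | (Minus, Minus) \<Rightarrow> z
        | (Plus, Minus) \<Rightarrow> t_number t upper
        | (Minus, Plus) \<Rightarrow> (1 - t) * z)
     else 0)"

definition uncol_states ::
  "nat \<Rightarrow> nat \<Rightarrow> (nat \<Rightarrow> nat) \<Rightarrow> ((nat \<times> nat \<Rightarrow> sign) \<times> (nat \<times> nat \<Rightarrow> nat)) set"
where
  "uncol_states r N lam =
    lattice_states r N UNIV UNIV uncol_adm (\<lambda>i. Plus) (\<lambda>i. Minus)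
      (\<lambda>k. card {i \<in> {1..r}. lam i = k}) (\<lambda>k. 0)"

definition Z_uncol ::
  "nat \<Rightarrow> nat \<Rightarrow> 'a::comm_ring_1 \<Rightarrow> (nat \<Rightarrow> nat) \<Rightarrow> (nat \<Rightarrow> 'a) \<Rightarrow> 'a"
where
  "Z_uncol r N t lam z = partition_function r N (uncol_weight t) z (uncol_states r N lam)"

end

theory Submission
  imports Defs
begin

text \<open>
  Fix the upper edge of a fused vertex and sum over its lower edge. If a function \<open>f\<close> of the right
  spin takes the constant value \<open>\<kappa>\<close> on colors and has sum \<open>S\<close> over the dolors, then the resulting
  function of the left spin is \<open>z ^ r * (\<kappa> + (1 - t) * S)\<close> on each color and has sum
  \<open>z ^ (r - 1) * (S + t_number t n * \<kappa>)\<close> over the dolors, \<open>n\<close> being the number of bosons on the upper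
  edge. This is \<open>z ^ (r - 1)\<close> times the uncolored vertex. Hence, for a fixed upper boundary of a row,
  summing over the dolor on the left, the color on the right and all lower boundaries with given
  boson numbers gives \<open>z ^ (N * (r - 1))\<close> times the uncolored row, and the rows can be lumped one
  after the other. By conservation of colors and dolors the left and right boundaries of the states
  so obtained are automatically permutations, which accounts for the sum over \<open>w1\<close> and \<open>w2\<close>.
\<close>

abbreviation boson_spins :: "nat \<Rightarrow> (nat \<times> nat \<Rightarrow> nat) set" where
  "boson_spins r \<equiv> {1..r} \<times> {1..r} \<rightarrow>\<^sub>E UNIV"

section \<open>Fused vertices as sums over paths\<close>

text \<open>A list of \<open>r ^ 2\<close> entries that covers \<open>r ^ 2\<close> pairs has no
  repetitions.\<close>

lemma bij_labels: "bij_betw ((!) (labels r)) {..<r ^ 2} ({1..r} \<times> {1..r})"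
proof -
  have "distinct (labels r)"
    by (rule card_distinct) (simp add: set_labels length_labels power2_eq_square)
  then show ?thesis
    using bij_betw_nth[of "labels r"] by (simp add: set_labels length_labels)
qed

lemma fused_labellings_iff:
  "h \<in> fused_labellings r x A y B \<longleftrightarrow>
    h \<in> {..r ^ 2} \<rightarrow>\<^sub>E hspins r \<and> h 0 = x \<and> h (r ^ 2) = y \<and>
    (\<forall>k<r ^ 2. unfused_adm (fst (labels r ! k)) (snd (labels r ! k))
       (h k) (A (labels r ! k)) (h (Suc k)) (B (labels r ! k)))"
  unfolding fused_labellings_def mem_Collect_eq case_prod_beta prod.collapse ..

lemma finite_hspins: "finite (hspins r)"
  by (simp add: hspins_def)

lemma Color_in_hspins [simp]: "Color a \<in> hspins r \<longleftrightarrow> a \<in> {1..r}"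
  and Dolor_in_hspins [simp]: "Dolor a \<in> hspins r \<longleftrightarrow> a \<in> {1..r}"
  by (auto simp: hspins_def)

text \<open>
  A boson \<open>(c, d)\<close> is a color \<open>c\<close> travelling down together with a dolor \<open>d\<close> travelling up, so it
  carries the charge of \<open>c\<close> minus that of \<open>d\<close>.
\<close>

lemma fused_charge:
  fixes q :: "hspin \<Rightarrow> int"
  assumes "fused_adm r x A y B"
  shows "(\<Sum>p\<in>{1..r} \<times> {1..r}. (q (Color (fst p)) - q (Dolor (snd p))) * int (B p)) + q y =
    (\<Sum>p\<in>{1..r} \<times> {1..r}. (q (Color (fst p)) - q (Dolor (snd p))) * int (A p)) + q x"
proof -
  obtain h where h: "h \<in> fused_labellings r x A y B"
    using assms by (auto simp: fused_adm_def)
  let ?Q = "\<lambda>p. q (Color (fst p)) - q (Dolor (snd p))"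
  have reindex: "(\<Sum>p\<in>{1..r} \<times> {1..r}. f p) = (\<Sum>k<r ^ 2. f (labels r ! k))" for f :: "_ \<Rightarrow> int"
    by (rule sum.reindex_bij_betw[OF bij_labels, symmetric])
  have step: "?Q (labels r ! k) * int (B (labels r ! k)) - ?Q (labels r ! k) * int (A (labels r ! k)) =
      q (h k) - q (h (Suc k))" if "k < r ^ 2" for k
  proof -
    have "unfused_adm (fst (labels r ! k)) (snd (labels r ! k))
        (h k) (A (labels r ! k)) (h (Suc k)) (B (labels r ! k))"
      using h that unfolding fused_labellings_iff by blast
    then show ?thesis
      by (auto simp: unfused_adm_def algebra_simps)
  qed
  have "(\<Sum>p\<in>{1..r} \<times> {1..r}. ?Q p * int (B p)) - (\<Sum>p\<in>{1..r} \<times> {1..r}. ?Q p * int (A p))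
      = (\<Sum>k<r ^ 2. q (h k) - q (h (Suc k)))"
    unfolding sum_subtractf[symmetric] reindex by (intro sum.cong refl step) simp
  also have "\<dots> = q x - q y"
    using h by (subst sum_lessThan_telescope') (simp add: fused_labellings_def)
  finally show ?thesis by simp
qed

section \<open>Paths of horizontal spins inside a fused vertex\<close>

lemma sum_PiE_atMost_Suc:
  assumes "finite (X (Suc n))"
  shows "(\<Sum>h\<in>PiE {..Suc n} X. F h) =
    (\<Sum>h\<in>PiE {..n} X. \<Sum>y\<in>X (Suc n). F (h(Suc n := y)))"
proof -
  have "(\<Sum>h\<in>PiE {..Suc n} X. F h) = (\<Sum>(h, y)\<in>PiE {..n} X \<times> X (Suc n). F (h(Suc n := y)))"
    by (rule sum.reindex_bij_witness[where i = "\<lambda>(h, y). h(Suc n := y)"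
          and j = "\<lambda>h. (restrict h {..n}, h (Suc n))"])
      (auto simp: PiE_iff extensional_def restrict_def fun_eq_iff le_Suc_eq intro!: arg_cong[of _ _ F])
  also have "\<dots> = (\<Sum>h\<in>PiE {..n} X. \<Sum>y\<in>X (Suc n). F (h(Suc n := y)))"
    by (simp add: sum.cartesian_product)
  finally show ?thesis .
qed

text \<open>Distributivity when the factors are indexed by positions \<open>k\<close> but
  \<open>b\<close> by labels: each label stands at exactly one position, so the lower spins are
  summed independently.\<close>

lemma sum_PiE_prod_bij:
  fixes G :: "'k \<Rightarrow> 'b \<Rightarrow> 'a::comm_semiring_1"
  assumes l: "bij_betw l K P" and "finite K" and "\<And>p. p \<in> P \<Longrightarrow> finite (S p)"
  shows "(\<Sum>b\<in>PiE P S. \<Prod>k\<in>K. G k (b (l k))) = (\<Prod>k\<in>K. \<Sum>n\<in>S (l k). G k n)"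
proof -
  let ?i = "the_inv_into K l"
  have inj: "inj_on l K" using l by (simp add: bij_betw_def)
  have fin: "finite P" using l assms(2) by (metis bij_betw_finite)
  have re: "(\<Prod>k\<in>K. f k (l k)) = (\<Prod>p\<in>P. f (?i p) p)" for f :: "'k \<Rightarrow> 'c \<Rightarrow> 'a"
    by (subst prod.reindex_bij_betw[OF l, symmetric]) (simp add: the_inv_into_f_f[OF inj])
  show ?thesis
    using re[of "\<lambda>k p. \<Sum>n\<in>S p. G k n"] re[of "\<lambda>k p. G k (_ p)"]
    by (simp add: prod_sum_PiE[OF fin assms(3)] re[of "\<lambda>k p. G k (b p)" for b])
qed

text \<open>The unfused weight with the lower edge summed out: a transfer matrix in the two
  horizontal spins. For \<open>n = 0\<close> the entry from a dolor to a color vanishes, because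
  \<open>t_number t 0 = 0\<close>.\<close>

definition step_weight ::
  "'a::comm_ring_1 \<Rightarrow> nat \<Rightarrow> nat \<Rightarrow> 'a \<Rightarrow> hspin \<Rightarrow> nat \<Rightarrow> hspin \<Rightarrow> 'a"
where
  "step_weight t c d z x n y =
    (case (x, y) of
       (Dolor a, Dolor b) \<Rightarrow>
         if a \<noteq> b then 0 else if a = d then 1
         else z ^ (if c = 1 then 1 else 0) * t ^ (if a < d then n else 0)
     | (Color a, Color b) \<Rightarrow> if a \<noteq> b then 0 else if a = c then z else if c > a then t ^ n else 1
     | (Dolor a, Color b) \<Rightarrow> if a = d \<and> b = c then t_number t n else 0
     | (Color a, Dolor b) \<Rightarrow> if a = c \<and> b = d then (1 - t) * z else 0)"

text \<open>At most one lower spin is admissible, and it exceeds \<open>n\<close> by at most one, so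
  the range \<open>m \<le> Suc n\<close> catches it.\<close>

lemma sum_unfused_weight:
  "(\<Sum>m\<le>Suc n. unfused_weight t c d z x n y m) = step_weight t c d z x n y"
proof -
  have pick: "(\<Sum>m\<le>Suc n. if m = k then w else 0) = (if k \<le> Suc n then w else 0)" for k and w :: 'a
    by (subst sum.delta) auto
  show ?thesis
  proof (cases x; cases y)
    fix a b assume xy: "x = Dolor a" "y = Color b"
    \<comment> \<open>For \<open>n = 0\<close> the truncated \<open>n - 1\<close> points at an
      inadmissible lower spin; \<open>t_number t 0 = 0\<close> removes that term.\<close>
    have "unfused_weight t c d z x n y m =
        (if m = n - 1 then if a = d \<and> b = c then t_number t n else 0 else 0)" for m
      using xy by (cases "n = 0") (auto simp: unfused_weight_def unfused_adm_def t_number_def)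
    moreover have "n - 1 \<le> Suc n" by simp
    ultimately show ?thesis
      using xy by (simp only: pick if_True) (simp add: step_weight_def)
  next
    fix a b assume xy: "x = Dolor a" "y = Dolor b"
    have "unfused_weight t c d z x n y m = (if m = n then step_weight t c d z x n y else 0)" for m
      using xy by (auto simp: unfused_weight_def unfused_adm_def step_weight_def)
    then show ?thesis by (simp add: pick del: sum.atMost_Suc)
  next
    fix a b assume xy: "x = Color a" "y = Dolor b"
    have "unfused_weight t c d z x n y m = (if m = Suc n then step_weight t c d z x n y else 0)" for m
      using xy by (auto simp: unfused_weight_def unfused_adm_def step_weight_def)
    then show ?thesis by (simp add: pick del: sum.atMost_Suc)
  next
    fix a b assume xy: "x = Color a" "y = Color b"
    have "unfused_weight t c d z x n y m = (if m = n then step_weight t c d z x n y else 0)" for m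
      using xy by (auto simp: unfused_weight_def unfused_adm_def step_weight_def)
    then show ?thesis by (simp add: pick del: sum.atMost_Suc)
  qed
qed

text \<open>Only the left end is fixed. Admissibility and the right end are left out so that the set
  is a product and can be summed edge by edge.\<close>

definition label_paths :: "nat \<Rightarrow> hspin \<Rightarrow> nat \<Rightarrow> (nat \<Rightarrow> hspin) set" where
  "label_paths r x n = PiE {..n} (\<lambda>k. if k = 0 then {x} else hspins r)"

lemma finite_label_paths: "finite (label_paths r x n)"
  unfolding label_paths_def by (rule finite_PiE) (auto simp: finite_hspins)

lemma label_paths_0: "h \<in> label_paths r x n \<Longrightarrow> h 0 = x"
  unfolding label_paths_def PiE_iff by force

lemma label_paths_hspins: "h \<in> label_paths r x n \<Longrightarrow> x \<in> hspins r \<Longrightarrow> h \<in> {..n} \<rightarrow>\<^sub>E hspins r"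
  unfolding label_paths_def PiE_iff by (metis singletonD)

text \<open>The labelling picked by \<open>THE\<close> is the only one, so the fused weight is a sum
  over all labellings. Every other path ending in \<open>y\<close> passes an inadmissible unfused
  vertex and contributes 0.\<close>

lemma fused_weight_path_sum:
  assumes "x \<in> hspins r"
  shows "fused_weight r t z x A y B =
    (\<Sum>h\<in>label_paths r x (r ^ 2). of_bool (h (r ^ 2) = y) *
       (\<Prod>k<r ^ 2. unfused_weight t (fst (labels r ! k)) (snd (labels r ! k)) z
          (h k) (A (labels r ! k)) (h (Suc k)) (B (labels r ! k))))"
    (is "_ = (\<Sum>h\<in>?P. _ * ?w h)")
proof -
  let ?L = "fused_labellings r x A y B"
  have "?L \<subseteq> ?P"
    by (rule subsetI) (simp add: fused_labellings_iff label_paths_def PiE_iff)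
  moreover have "of_bool (h (r ^ 2) = y) * ?w h = 0" if h: "h \<in> ?P - ?L" for h
  proof (cases "h (r ^ 2) = y")
    case True
    from h have "h \<in> ?P" by simp
    with h True obtain k where k: "k < r ^ 2" "\<not> unfused_adm (fst (labels r ! k)) (snd (labels r ! k))
        (h k) (A (labels r ! k)) (h (Suc k)) (B (labels r ! k))"
      using label_paths_hspins[OF _ assms, of h "r ^ 2"] label_paths_0[of h r x "r ^ 2"]
      by (simp add: fused_labellings_iff) blast
    have "?w h = 0"
      by (rule prod_zero[OF finite_lessThan bexI[of _ k]]) (use k in \<open>simp_all add: unfused_weight_def\<close>)
    then show ?thesis by simp
  qed simp
  ultimately have "(\<Sum>h\<in>?P. of_bool (h (r ^ 2) = y) * ?w h) = (\<Sum>h\<in>?L. of_bool (h (r ^ 2) = y) * ?w h)"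
    by (intro sum.mono_neutral_right finite_label_paths) simp_all
  also have "\<dots> = fused_weight r t z x A y B"
  proof (cases "?L = {}")
    case True
    then show ?thesis by (simp add: fused_weight_def fused_adm_def)
  next
    case False
    then obtain h where h: "h \<in> ?L" by auto
    have L: "?L = {h}"
    proof (rule set_eqI)
      fix g
      show "g \<in> ?L \<longleftrightarrow> g \<in> {h}"
        using h fused_labellings_unique[of g r x A y B h] by auto
    qed
    have "h (r ^ 2) = y" using h by (simp add: fused_labellings_iff)
    then show ?thesis by (simp add: fused_weight_def fused_adm_def L Let_def case_prod_beta)
  qed
  finally show ?thesis by simp
qed

text \<open>Each label occurs once in a fused vertex, so each multiplicity grows by at most one.
  This box contains all reachable lower spins, and sums of products over it factor.\<close>

definition fused_lowers :: "nat \<Rightarrow> (nat \<times> nat \<Rightarrow> nat) \<Rightarrow> (nat \<times> nat \<Rightarrow> nat) set" where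
  "fused_lowers r A = PiE ({1..r} \<times> {1..r}) (\<lambda>p. {..Suc (A p)})"

lemma finite_fused_lowers: "finite (fused_lowers r A)"
  unfolding fused_lowers_def by (rule finite_PiE) auto

lemma fused_lowersI:
  assumes "B \<in> boson_spins r" "fused_adm r x A y B"
  shows "B \<in> fused_lowers r A"
proof -
  obtain h where h: "h \<in> fused_labellings r x A y B"
    using assms by (auto simp: fused_adm_def)
  have "B p \<le> Suc (A p)" if p: "p \<in> {1..r} \<times> {1..r}" for p
  proof -
    obtain k where k: "k < r ^ 2" "labels r ! k = p"
      using p[folded bij_betw_imp_surj_on[OF bij_labels[of r]]] by auto
    have "unfused_adm (fst (labels r ! k)) (snd (labels r ! k))
        (h k) (A (labels r ! k)) (h (Suc k)) (B (labels r ! k))"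
      using h k(1) unfolding fused_labellings_iff by blast
    then show ?thesis
      unfolding k(2) by (auto simp: unfused_adm_def)
  qed
  then show ?thesis using assms(1) by (auto simp: fused_lowers_def PiE_iff)
qed

lemma finite_fused_lower_spins: "finite {B \<in> boson_spins r. fused_adm r x A y B}"
  by (rule finite_subset[OF _ finite_fused_lowers[of r A]]) (use fused_lowersI in blast)

section \<open>Transfer operators of unfused vertices\<close>

definition label_step ::
  "nat \<Rightarrow> 'a::comm_ring_1 \<Rightarrow> 'a \<Rightarrow> (nat \<times> nat \<Rightarrow> nat) \<Rightarrow> nat \<times> nat \<Rightarrow> (hspin \<Rightarrow> 'a) \<Rightarrow> hspin \<Rightarrow> 'a"
where
  "label_step r t z A p f x = (\<Sum>y\<in>hspins r. step_weight t (fst p) (snd p) z x (A p) y * f y)"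

text \<open>Summing over the last edge of a path turns the test function \<open>f\<close> at that
  edge into its image under \<open>label_step\<close> at the previous edge; hence the induction is
  over all \<open>f\<close>.\<close>

lemma foldr_label_step:
  assumes "n \<le> r ^ 2"
  shows "(\<Sum>h\<in>label_paths r x n. (\<Prod>k<n. step_weight t (fst (labels r ! k)) (snd (labels r ! k)) z
      (h k) (A (labels r ! k)) (h (Suc k))) * f (h n)) =
    foldr (label_step r t z A) (take n (labels r)) f x"
  using assms
proof (induction n arbitrary: f)
  case 0
  have "h \<in> label_paths r x 0 \<longleftrightarrow> h = (\<lambda>k. if k = 0 then x else undefined)" for h
    unfolding label_paths_def PiE_iff extensional_def by (simp add: fun_eq_iff) metis
  then have "label_paths r x 0 = {\<lambda>k. if k = 0 then x else undefined}"
    by (simp add: set_eq_iff)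
  then show ?case by simp
next
  case (Suc n)
  let ?w = "\<lambda>k. step_weight t (fst (labels r ! k)) (snd (labels r ! k)) z"
  let ?l = "labels r ! n"
  have n: "take (Suc n) (labels r) = take n (labels r) @ [?l]"
    using Suc.prems by (simp add: take_Suc_conv_app_nth length_labels)
  have "(\<Sum>h\<in>label_paths r x (Suc n). (\<Prod>k<Suc n. ?w k (h k) (A (labels r ! k)) (h (Suc k))) * f (h (Suc n)))
     = (\<Sum>h\<in>label_paths r x n. \<Sum>y\<in>hspins r.
          (\<Prod>k<n. ?w k (h k) (A (labels r ! k)) (h (Suc k))) * (?w n (h n) (A ?l) y * f y))"
    unfolding label_paths_def
    by (subst sum_PiE_atMost_Suc) (auto simp: finite_hspins mult.assoc intro!: sum.cong prod.cong)
  also have "\<dots> = (\<Sum>h\<in>label_paths r x n. (\<Prod>k<n. ?w k (h k) (A (labels r ! k)) (h (Suc k))) *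
       label_step r t z A ?l f (h n))"
    by (simp add: label_step_def sum_distrib_left)
  also have "\<dots> = foldr (label_step r t z A) (take (Suc n) (labels r)) f x"
    using Suc by (simp add: n)
  finally show ?case .
qed

text \<open>With the upper spin fixed, the sum over the lower spins factors over the unfused
  vertices, so the fused vertex becomes the composition of their transfer operators, the rightmost
  acting first.\<close>

lemma sum_fused_weight:
  assumes "x \<in> hspins r"
  shows "(\<Sum>y\<in>hspins r. (\<Sum>B | B \<in> boson_spins r \<and> fused_adm r x A y B.
      fused_weight r t z x A y B) * f y) = foldr (label_step r t z A) (labels r) f x"
proof -
  let ?W = "\<lambda>h k. step_weight t (fst (labels r ! k)) (snd (labels r ! k)) z
      (h k) (A (labels r ! k)) (h (Suc k))"
  let ?P = "label_paths r x (r ^ 2)"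
  have "(\<Sum>B | B \<in> boson_spins r \<and> fused_adm r x A y B. fused_weight r t z x A y B)
      = (\<Sum>h\<in>?P. of_bool (h (r ^ 2) = y) * (\<Prod>k<r ^ 2. ?W h k))" for y
  proof -
    \<comment> \<open>Passing to the box adds only inadmissible lower spins, which have weight
      0.\<close>
    have "(\<Sum>B | B \<in> boson_spins r \<and> fused_adm r x A y B. fused_weight r t z x A y B)
        = (\<Sum>B\<in>fused_lowers r A. fused_weight r t z x A y B)"
    proof (rule sum.mono_neutral_left[OF finite_fused_lowers])
      show "{B. B \<in> boson_spins r \<and> fused_adm r x A y B} \<subseteq> fused_lowers r A"
        using fused_lowersI by blast
      have "B \<in> boson_spins r" if "B \<in> fused_lowers r A" for B
        using that by (simp add: fused_lowers_def PiE_iff)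
      then show "\<forall>B\<in>fused_lowers r A - {B. B \<in> boson_spins r \<and> fused_adm r x A y B}.
          fused_weight r t z x A y B = 0"
        by (simp add: fused_weight_def)
    qed
    also have "\<dots> = (\<Sum>h\<in>?P. of_bool (h (r ^ 2) = y) * (\<Sum>B\<in>fused_lowers r A.
       (\<Prod>k<r ^ 2. unfused_weight t (fst (labels r ! k)) (snd (labels r ! k)) z (h k) (A (labels r ! k)) (h (Suc k)) (B (labels r ! k)))))"
      unfolding fused_weight_path_sum[OF assms]
      by (subst sum.swap) (simp add: sum_distrib_left)
    also have "\<dots> = (\<Sum>h\<in>?P. of_bool (h (r ^ 2) = y) * (\<Prod>k<r ^ 2. ?W h k))"
      unfolding fused_lowers_def
      by (subst sum_PiE_prod_bij[OF bij_labels]) (auto simp: sum_unfused_weight simp del: sum.atMost_Suc)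
    finally show ?thesis .
  qed
  then have "(\<Sum>y\<in>hspins r. (\<Sum>B | B \<in> boson_spins r \<and> fused_adm r x A y B.
      fused_weight r t z x A y B) * f y) =
      (\<Sum>y\<in>hspins r. \<Sum>h\<in>?P. of_bool (h (r ^ 2) = y) * (\<Prod>k<r ^ 2. ?W h k) * f y)"
    by (simp add: sum_distrib_right)
  also have "\<dots> = (\<Sum>h\<in>?P. \<Sum>y\<in>hspins r. if y = h (r ^ 2) then (\<Prod>k<r ^ 2. ?W h k) * f y else 0)"
    by (subst sum.swap) (auto intro!: sum.cong)
  also have "\<dots> = (\<Sum>h\<in>?P. (\<Prod>k<r ^ 2. ?W h k) * f (h (r ^ 2)))"
  proof (rule sum.cong[OF refl])
    fix h assume "h \<in> ?P"
    then have "h (r ^ 2) \<in> hspins r"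
      using label_paths_hspins[OF _ assms] by blast
    then show "(\<Sum>y\<in>hspins r. if y = h (r ^ 2) then (\<Prod>k<r ^ 2. ?W h k) * f y else 0) =
        (\<Prod>k<r ^ 2. ?W h k) * f (h (r ^ 2))"
      by (simp add: finite_hspins)
  qed
  also have "\<dots> = foldr (label_step r t z A) (labels r) f x"
    by (subst foldr_label_step[OF order_refl]) (simp add: length_labels)
  finally show ?thesis .
qed

section \<open>Forgetting colors and dolors at a vertex\<close>

lemma t_number_0 [simp]: "t_number t 0 = 0"
  by (simp add: t_number_def)

text \<open>This replaces division by \<open>1 - t\<close>, so that \<open>t = 1\<close> is covered
  as well.\<close>

lemma one_minus_times_t_number: "(1 - t) * t_number t n = 1 - t ^ n"
  by (simp add: t_number_def one_diff_power_eq)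

lemma t_number_add: "t_number t (m + n) = t_number t m + t ^ m * t_number t n"
  unfolding t_number_def by (induction n) (simp_all add: power_add algebra_simps)

lemma sum_hspins:
  fixes g :: "hspin \<Rightarrow> 'a::comm_monoid_add"
  shows "(\<Sum>y\<in>hspins r. g y) = (\<Sum>a\<in>{1..r}. g (Color a)) + (\<Sum>a\<in>{1..r}. g (Dolor a))"
  unfolding hspins_def
  by (subst sum.union_disjoint) (auto simp: sum.reindex inj_on_def)

section \<open>Action of one unfused vertex on a function of the right spin\<close>

lemma label_step_Dolor:
  assumes "x \<in> {1..r}" "c \<in> {1..r}"
  shows "label_step r t z A (c, d) f (Dolor x) =
    (if x = d then f (Dolor d) + t_number t (A (c, d)) * f (Color c)
     else z ^ (if c = 1 then 1 else 0) * t ^ (if x < d then A (c, d) else 0) * f (Dolor x))"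
proof -
  let ?w = "step_weight t c d z (Dolor x) (A (c, d))"
  have "?w (Color a) * f (Color a) = (if a = c then if x = d then t_number t (A (c, d)) * f (Color c) else 0 else 0)"
    and "?w (Dolor a) * f (Dolor a) = (if a = x then (if x = d then 1
        else z ^ (if c = 1 then 1 else 0) * t ^ (if x < d then A (c, d) else 0)) * f (Dolor x) else 0)" for a
    by (simp_all add: step_weight_def)
  then show ?thesis
    using assms by (simp add: label_step_def sum_hspins)
qed

lemma label_step_Color:
  assumes "a \<in> {1..r}" "d \<in> {1..r}"
  shows "label_step r t z A (c, d) f (Color a) =
    (if a = c then z * (f (Color c) + (1 - t) * f (Dolor d))
     else t ^ (if a < c then A (c, d) else 0) * f (Color a))"
proof -
  let ?w = "step_weight t c d z (Color a) (A (c, d))"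
  have "?w (Dolor b) * f (Dolor b) = (if b = d then if a = c then (1 - t) * z * f (Dolor d) else 0 else 0)"
    and "?w (Color b) * f (Color b) = (if b = a then (if a = c then z
        else t ^ (if a < c then A (c, d) else 0)) * f (Color a) else 0)" for b
    by (simp_all add: step_weight_def)
  then show ?thesis
    using assms by (simp add: label_step_def sum_hspins algebra_simps)
qed

definition dolor_row :: "nat \<Rightarrow> nat \<Rightarrow> nat \<Rightarrow> (nat \<times> nat) list" where
  "dolor_row r j d = map (\<lambda>c. (c, d)) [Suc j..<Suc r]"

text \<open>
  \<open>foldr\<close> applies the rightmost unfused vertex first: within a block of fixed dolor the colors are
  processed in decreasing order, and the blocks themselves in increasing order of the dolor.
\<close>

lemma foldr_dolor_row:
  fixes A :: "nat \<times> nat \<Rightarrow> nat" and t z \<kappa> :: "'a::comm_ring_1"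
  assumes d: "d \<in> {1..r}" and f: "\<And>a. a \<in> {1..r} \<Longrightarrow> f (Color a) = \<kappa>" and "j \<le> r"
  defines "n \<equiv> \<lambda>j. \<Sum>c\<in>{Suc j..r}. A (c, d)"
  defines "F \<equiv> \<lambda>j. foldr (label_step r t z A) (dolor_row r j d) f"
  shows "F j (Dolor d) = f (Dolor d) + t_number t (n j) * \<kappa> \<and>
    (\<forall>x\<in>{1..r} - {d}. F j (Dolor x) =
       z ^ (if j = 0 then 1 else 0) * t ^ (if x < d then n j else 0) * f (Dolor x)) \<and>
    (\<forall>a\<in>{1..r}. F j (Color a) =
       (if a \<le> j then t ^ n j * \<kappa> else z * (\<kappa> + (1 - t) * f (Dolor d))))"
  using \<open>j \<le> r\<close>
\<comment> \<open>Going down from \<open>j = r\<close> adds vertices on the left. A color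
  \<open>a \<le> j\<close> has not met its own vertex and collects powers of \<open>t\<close>;
  afterwards its value is frozen, because the labels still to be added have smaller colors. Dolors
  other than \<open>d\<close> get their factor \<open>z\<close> at color 1, which is added
  last.\<close>
proof (induction j rule: inc_induct)
  case base
  have "F r = f" by (simp add: F_def dolor_row_def)
  moreover have "n r = 0" by (simp add: n_def)
  moreover have "r \<noteq> 0" using d by auto
  ultimately show ?case using f by simp
next
  case (step j)
  have F: "F j = label_step r t z A (Suc j, d) (F (Suc j))"
    using step.hyps by (simp add: F_def dolor_row_def upt_conv_Cons del: upt_Suc)
  have n: "n j = n (Suc j) + A (Suc j, d)"
    using step.hyps by (simp add: n_def sum.atLeast_Suc_atMost add.commute)
  have j: "Suc j \<in> {1..r}" using step.hyps by simp
  \<comment> \<open>At its own vertex a color sees \<open>t ^ n (Suc j) * \<kappa>\<close> and the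
    dolor \<open>d\<close>, which has picked up \<open>t_number t (n (Suc j)) * \<kappa>\<close>.
    Multiplying the latter by \<open>1 - t\<close> makes the powers of \<open>t\<close> cancel, and
    \<open>\<kappa>\<close> reappears.\<close>
  have "z * (t ^ n (Suc j) * \<kappa> + (1 - t) * (f (Dolor d) + t_number t (n (Suc j)) * \<kappa>)) =
      z * (t ^ n (Suc j) * \<kappa> + (1 - t) * f (Dolor d) + ((1 - t) * t_number t (n (Suc j))) * \<kappa>)"
    by (simp add: algebra_simps)
  also have "\<dots> = z * (\<kappa> + (1 - t) * f (Dolor d))"
    unfolding one_minus_times_t_number by (simp add: algebra_simps)
  finally have own: "z * (t ^ n (Suc j) * \<kappa> + (1 - t) * (f (Dolor d) + t_number t (n (Suc j)) * \<kappa>)) =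
      z * (\<kappa> + (1 - t) * f (Dolor d))" .
  note IH = step.IH[THEN conjunct1] step.IH[THEN conjunct2, THEN conjunct1, rule_format]
    step.IH[THEN conjunct2, THEN conjunct2, rule_format]
  show ?case
  proof (intro conjI ballI)
    show "F j (Dolor d) = f (Dolor d) + t_number t (n j) * \<kappa>"
      using d j by (simp add: F label_step_Dolor IH n t_number_add algebra_simps)
    fix x assume "x \<in> {1..r} - {d}"
    then show "F j (Dolor x) =
       z ^ (if j = 0 then 1 else 0) * t ^ (if x < d then n j else 0) * f (Dolor x)"
      using d j by (auto simp add: F label_step_Dolor IH n power_add algebra_simps)
  next
    fix a assume a: "a \<in> {1..r}"
    show "F j (Color a) =
       (if a \<le> j then t ^ n j * \<kappa> else z * (\<kappa> + (1 - t) * f (Dolor d)))"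
    proof (cases "a = Suc j")
      case True
      then show ?thesis using d j own by (simp add: F label_step_Color IH)
    next
      case False
      then show ?thesis
        using d j a by (auto simp: F label_step_Color IH n power_add algebra_simps)
    qed
  qed
qed

text \<open>Each block multiplies every dolor but its own by \<open>z\<close>, whence the exponent
  \<open>e - 1\<close> for the sum over the first \<open>e\<close> dolors. This sum evolves on its
  own: the factor \<open>t ^ m\<close> that a block with \<open>m\<close> bosons puts on the earlier
  dolors is made up for by what its own dolor receives from the colors.\<close>

lemma foldr_dolor_rows:
  fixes A :: "nat \<times> nat \<Rightarrow> nat" and t z \<kappa> :: "'a::comm_ring_1"
  assumes f: "\<And>a. a \<in> {1..r} \<Longrightarrow> f (Color a) = \<kappa>" and "e \<le> r"
  defines "n \<equiv> \<lambda>e. \<Sum>d\<in>{1..e}. \<Sum>c\<in>{1..r}. A (c, d)"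
  defines "F \<equiv> \<lambda>e. foldr (label_step r t z A) (concat (map (dolor_row r 0) (rev [1..<Suc e]))) f"
  shows "(\<forall>a\<in>{1..r}. F e (Color a) = z ^ e * (\<kappa> + (1 - t) * (\<Sum>x\<in>{1..e}. f (Dolor x)))) \<and>
    (\<Sum>x\<in>{1..e}. F e (Dolor x)) = z ^ (e - 1) * ((\<Sum>x\<in>{1..e}. f (Dolor x)) + t_number t (n e) * \<kappa>) \<and>
    (\<forall>x\<in>{e<..r}. F e (Dolor x) = z ^ e * f (Dolor x))"
  using \<open>e \<le> r\<close>
proof (induction e)
  case 0
  have "F 0 = f" by (simp add: F_def)
  moreover have "n 0 = 0" by (simp add: n_def)
  ultimately show ?case using f by simp
next
  case (Suc e)
  let ?S = "\<Sum>x\<in>{1..e}. f (Dolor x)"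
  let ?\<kappa> = "z ^ e * (\<kappa> + (1 - t) * ?S)"
  let ?m = "\<Sum>c\<in>{1..r}. A (c, Suc e)"
  have IH: "F e (Color a) = ?\<kappa>" "(\<Sum>x\<in>{1..e}. F e (Dolor x)) = z ^ (e - 1) * (?S + t_number t (n e) * \<kappa>)"
    "x \<in> {e<..r} \<Longrightarrow> F e (Dolor x) = z ^ e * f (Dolor x)" if "a \<in> {1..r}" for a x
    using Suc that by auto
  have F: "F (Suc e) = foldr (label_step r t z A) (dolor_row r 0 (Suc e)) (F e)"
    by (simp add: F_def)
  have e: "Suc e \<in> {1..r}" using Suc.prems by simp
  note row = foldr_dolor_row[OF e, where f = "F e" and \<kappa> = ?\<kappa> and j = 0 and t = t and z = z and A = A,
      OF IH(1) le0, folded F]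
  have Fcol: "F (Suc e) (Color a) = z ^ Suc e * (\<kappa> + (1 - t) * (\<Sum>x\<in>{1..Suc e}. f (Dolor x)))"
    if "a \<in> {1..r}" for a
    using row[THEN conjunct2, THEN conjunct2] that e IH(3)[OF e, of "Suc e"] by (simp add: algebra_simps)
  have Fnew: "F (Suc e) (Dolor (Suc e)) = z ^ e * f (Dolor (Suc e)) + t_number t ?m * ?\<kappa>"
    using row[THEN conjunct1] e IH(3)[OF e, of "Suc e"] by simp
  have Fold: "F (Suc e) (Dolor x) = z * t ^ ?m * F e (Dolor x)" if "x \<in> {1..e}" for x
    using row[THEN conjunct2, THEN conjunct1] that e by simp
  have Fother: "F (Suc e) (Dolor x) = z ^ Suc e * f (Dolor x)" if "x \<in> {Suc e<..r}" for x
    using row[THEN conjunct2, THEN conjunct1] that e IH(3)[OF e, of x] by (simp add: mult.assoc)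
  have n: "n (Suc e) = ?m + n e" by (simp add: n_def)
  \<comment> \<open>For \<open>e = 0\<close> the exponent \<open>e - 1\<close> is truncated, but
    then the bracket is 0.\<close>
  have zz: "z * (z ^ (e - 1) * (?S + t_number t (n e) * \<kappa>)) = z ^ e * (?S + t_number t (n e) * \<kappa>)"
    by (cases e) (simp_all add: n_def mult.assoc)
  have "(\<Sum>x\<in>{1..Suc e}. F (Suc e) (Dolor x)) =
      t ^ ?m * (z * (\<Sum>x\<in>{1..e}. F e (Dolor x))) + F (Suc e) (Dolor (Suc e))"
    by (simp add: Fold sum_distrib_left mult.assoc mult.left_commute)
  also have "\<dots> = z ^ e * (t ^ ?m * ?S + t ^ ?m * t_number t (n e) * \<kappa> + f (Dolor (Suc e)) +
      t_number t ?m * \<kappa> + ((1 - t) * t_number t ?m) * ?S)"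
    unfolding IH(2)[OF e] zz Fnew by (simp add: algebra_simps)
  \<comment> \<open>\<open>t ^ ?m * ?S\<close> and \<open>(1 - t) * t_number t ?m * ?S\<close> add
    up to \<open>?S\<close>; the two multiples of \<open>\<kappa>\<close> combine by
    \<open>t_number_add\<close>.\<close>
  also have "\<dots> = z ^ e * ((\<Sum>x\<in>{1..Suc e}. f (Dolor x)) + t_number t (n (Suc e)) * \<kappa>)"
    unfolding one_minus_times_t_number n t_number_add by (simp add: algebra_simps)
  finally show ?case using Fcol Fother by auto
qed

lemma labels_eq: "labels r = concat (map (dolor_row r 0) (rev [1..<Suc r]))"
  by (simp only: labels_def dolor_row_def[abs_def] One_nat_def)

text \<open>
  Up to the factor \<open>z ^ (r - 1)\<close>, this is the action of the uncolored vertex on the pair \<open>(\<kappa>, S)\<close>: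
  partition functions of the columns to the right stay independent of an incoming color, and only
  their sum over the incoming dolors matters.
\<close>

lemma fused_lump:
  fixes A :: "nat \<times> nat \<Rightarrow> nat" and t z \<kappa> :: "'a::comm_ring_1"
  assumes f: "\<And>a. a \<in> {1..r} \<Longrightarrow> f (Color a) = \<kappa>"
  defines "F \<equiv> foldr (label_step r t z A) (labels r) f" and "S \<equiv> \<Sum>x\<in>{1..r}. f (Dolor x)"
  shows "a \<in> {1..r} \<Longrightarrow> F (Color a) = z ^ r * (\<kappa> + (1 - t) * S)"
    and "(\<Sum>x\<in>{1..r}. F (Dolor x)) =
      z ^ (r - 1) * (S + t_number t (\<Sum>p\<in>{1..r} \<times> {1..r}. A p) * \<kappa>)"
proof -
  have "(\<Sum>d\<in>{1..r}. \<Sum>c\<in>{1..r}. A (c, d)) = (\<Sum>p\<in>{1..r} \<times> {1..r}. A p)"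
    by (subst sum.swap) (simp add: sum.cartesian_product)
  then show "a \<in> {1..r} \<Longrightarrow> F (Color a) = z ^ r * (\<kappa> + (1 - t) * S)"
    and "(\<Sum>x\<in>{1..r}. F (Dolor x)) =
      z ^ (r - 1) * (S + t_number t (\<Sum>p\<in>{1..r} \<times> {1..r}. A p) * \<kappa>)"
    using foldr_dolor_rows[of r f \<kappa> r t z A, OF f order_refl]
    unfolding F_def S_def labels_eq by simp_all
qed

section \<open>Forgetting colors and dolors in a row\<close>

text \<open>The end spins range over sets, because all dolors on the left and all colors on the
  right are to be summed. Given the horizontal spins, the lower spins of different columns are
  independent.\<close>

definition row_states ::
  "nat \<Rightarrow> 'h set \<Rightarrow> 'v set \<Rightarrow> ('h \<Rightarrow> 'v \<Rightarrow> 'h \<Rightarrow> 'v \<Rightarrow> bool) \<Rightarrow> 'h set \<Rightarrow> 'h set \<Rightarrow> (nat \<Rightarrow> 'v) \<Rightarrow>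
   ((nat \<Rightarrow> 'h) \<times> (nat \<Rightarrow> 'v)) set"
where
  "row_states N hs vs adm Ls Rs A =
    (SIGMA \<eta>:{\<eta> \<in> {..N} \<rightarrow>\<^sub>E hs. \<eta> N \<in> Ls \<and> \<eta> 0 \<in> Rs}.
       \<Pi>\<^sub>E k\<in>{..<N}. {b \<in> vs. adm (\<eta> (Suc k)) (A k) (\<eta> k) b})"

text \<open>The row transfer operator, applied to a function \<open>g\<close> of the lower boundary
  and evaluated at the upper boundary \<open>A\<close>.\<close>

definition row_sum ::
  "nat \<Rightarrow> 'h set \<Rightarrow> 'v set \<Rightarrow> ('h \<Rightarrow> 'v \<Rightarrow> 'h \<Rightarrow> 'v \<Rightarrow> bool) \<Rightarrow> 'h set \<Rightarrow> 'h set \<Rightarrow>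
   ('h \<Rightarrow> 'v \<Rightarrow> 'h \<Rightarrow> 'v \<Rightarrow> 'a::comm_ring_1) \<Rightarrow> ((nat \<Rightarrow> 'v) \<Rightarrow> 'a) \<Rightarrow> (nat \<Rightarrow> 'v) \<Rightarrow> 'a"
where
  "row_sum N hs vs adm Ls Rs wt g A =
    (\<Sum>(\<eta>, B)\<in>row_states N hs vs adm Ls Rs A. (\<Prod>k<N. wt (\<eta> (Suc k)) (A k) (\<eta> k) (B k)) * g B)"

lemma finite_row_states:
  assumes "finite hs" "\<And>x u y. finite {b \<in> vs. adm x u y b}"
  shows "finite (row_states N hs vs adm Ls Rs A)"
proof -
  have "finite {\<eta> \<in> {..N} \<rightarrow>\<^sub>E hs. \<eta> N \<in> Ls \<and> \<eta> 0 \<in> Rs}"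
    by (rule finite_subset[of _ "{..N} \<rightarrow>\<^sub>E hs"]) (auto simp: assms(1) intro: finite_PiE)
  then show ?thesis
    unfolding row_states_def by (intro finite_SigmaI finite_PiE assms(2)) auto
qed

text \<open>The boson number that conservation forces below a vertex. Truncation matters only for
  left \<open>Plus\<close>, right \<open>Minus\<close> and \<open>n = 0\<close>, where no vertex is
  admissible.\<close>

definition column_count :: "sign \<Rightarrow> nat \<Rightarrow> sign \<Rightarrow> nat" where
  "column_count \<sigma> n \<sigma>' = n + of_bool (\<sigma> = Minus) - of_bool (\<sigma>' = Minus)"

text \<open>
  The total weight of the rows whose horizontal spins have the signs \<open>\<sigma>\<close>; these signs determine how
  many bosons leave each column.
\<close>

definition sign_weight ::
  "'h set \<Rightarrow> 'v set \<Rightarrow> ('h \<Rightarrow> 'v \<Rightarrow> 'h \<Rightarrow> 'v \<Rightarrow> bool) \<Rightarrow> ('h \<Rightarrow> 'v \<Rightarrow> 'h \<Rightarrow> 'v \<Rightarrow> 'a::comm_ring_1) \<Rightarrow>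
   ('h \<Rightarrow> sign) \<Rightarrow> nat \<Rightarrow> (nat \<Rightarrow> 'v) \<Rightarrow> (nat \<Rightarrow> sign) \<Rightarrow> 'a"
where
  "sign_weight hs vs adm wt sg N A \<sigma> =
    (\<Sum>\<eta>\<in>(\<Pi>\<^sub>E k\<in>{..N}. {x \<in> hs. sg x = \<sigma> k}).
       \<Prod>k<N. \<Sum>b | b \<in> vs \<and> adm (\<eta> (Suc k)) (A k) (\<eta> k) b. wt (\<eta> (Suc k)) (A k) (\<eta> k) b)"

lemma finite_UNIV_sign: "finite (UNIV :: sign set)"
proof -
  have "(UNIV :: sign set) = {Plus, Minus}" using sign.exhaust by auto
  then show ?thesis by (metis finite.emptyI finite.insertI)
qed

text \<open>Rows are grouped by the signs of their horizontal spins. The signs fix the boson numbers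
  below the row, so \<open>g\<close> is constant on each group, and the remaining sum over lower
  spins factors over the columns. The bicolored model takes \<open>sg = hsign\<close>, the uncolored
  one \<open>sg = id\<close>.\<close>

lemma sum_row_states:
  fixes wt :: "'h \<Rightarrow> 'v \<Rightarrow> 'h \<Rightarrow> 'v \<Rightarrow> 'a::comm_ring_1"
  assumes hs: "finite hs" and fin: "\<And>x u y. finite {b \<in> vs. adm x u y b}"
    and cnt: "\<And>x u y b. adm x u y b \<Longrightarrow> cnt b = column_count (sg x) (cnt u) (sg y)"
  shows "row_sum N hs vs adm {x \<in> hs. sg x = Plus} {x \<in> hs. sg x = Minus} wt
      (\<lambda>B. g (\<lambda>k\<in>{..<N}. cnt (B k))) A =
    (\<Sum>\<sigma> | \<sigma> \<in> {..N} \<rightarrow>\<^sub>E UNIV \<and> \<sigma> N = Plus \<and> \<sigma> 0 = Minus. sign_weight hs vs adm wt sg N A \<sigma> *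
      g (\<lambda>k\<in>{..<N}. column_count (\<sigma> (Suc k)) (cnt (A k)) (\<sigma> k)))"
proof -
  let ?E = "{\<eta> \<in> {..N} \<rightarrow>\<^sub>E hs. \<eta> N \<in> {x \<in> hs. sg x = Plus} \<and> \<eta> 0 \<in> {x \<in> hs. sg x = Minus}}"
  let ?T = "{\<sigma>. \<sigma> \<in> {..N} \<rightarrow>\<^sub>E UNIV \<and> \<sigma> N = Plus \<and> \<sigma> 0 = Minus}"
  let ?S = "\<lambda>\<eta> k. {b \<in> vs. adm (\<eta> (Suc k)) (A k) (\<eta> k) b}"
  let ?s = "\<lambda>\<eta>. \<lambda>k\<in>{..N}. sg (\<eta> k)"
  let ?M = "\<lambda>\<eta>. \<Prod>k<N. \<Sum>b\<in>?S \<eta> k. wt (\<eta> (Suc k)) (A k) (\<eta> k) b"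
  let ?g = "\<lambda>\<sigma>. g (\<lambda>k\<in>{..<N}. column_count (\<sigma> (Suc k)) (cnt (A k)) (\<sigma> k))"
  have finE: "finite ?E"
    by (rule finite_subset[of _ "{..N} \<rightarrow>\<^sub>E hs"]) (auto simp: hs intro: finite_PiE)
  have "finite ({..N} \<rightarrow>\<^sub>E (UNIV :: sign set))"
    by (simp add: finite_PiE finite_UNIV_sign)
  then have finT: "finite ?T" by (rule finite_subset[rotated]) auto
  have obs: "(\<Sum>B\<in>PiE {..<N} (?S \<eta>). (\<Prod>k<N. wt (\<eta> (Suc k)) (A k) (\<eta> k) (B k)) *
      g (\<lambda>k\<in>{..<N}. cnt (B k))) = ?M \<eta> * ?g (?s \<eta>)" for \<eta>
  proof -
    have counts: "(\<lambda>k\<in>{..<N}. cnt (B k)) = (\<lambda>k\<in>{..<N}. column_count (?s \<eta> (Suc k)) (cnt (A k)) (?s \<eta> k))"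
      if "B \<in> PiE {..<N} (?S \<eta>)" for B
    proof (rule restrict_ext)
      fix k assume "k \<in> {..<N}"
      then have "adm (\<eta> (Suc k)) (A k) (\<eta> k) (B k)" using that by (auto simp: PiE_iff)
      then show "cnt (B k) = column_count (?s \<eta> (Suc k)) (cnt (A k)) (?s \<eta> k)"
        using \<open>k \<in> {..<N}\<close> by (subst cnt) auto
    qed
    have "(\<Sum>B\<in>PiE {..<N} (?S \<eta>). (\<Prod>k<N. wt (\<eta> (Suc k)) (A k) (\<eta> k) (B k)) *
        g (\<lambda>k\<in>{..<N}. cnt (B k))) =
        (\<Sum>B\<in>PiE {..<N} (?S \<eta>). \<Prod>k<N. wt (\<eta> (Suc k)) (A k) (\<eta> k) (B k)) * ?g (?s \<eta>)"
      unfolding sum_distrib_right by (intro sum.cong refl) (simp only: counts)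
    then show ?thesis
      using fin by (simp add: prod_sum_PiE)
  qed
  have "row_sum N hs vs adm {x \<in> hs. sg x = Plus} {x \<in> hs. sg x = Minus} wt
      (\<lambda>B. g (\<lambda>k\<in>{..<N}. cnt (B k))) A =
      (\<Sum>\<eta>\<in>?E. ?M \<eta> * ?g (?s \<eta>))"
    unfolding row_sum_def row_states_def
    by (subst sum.Sigma[symmetric]) (use finE fin obs in \<open>auto intro!: finite_PiE\<close>)
  also have "\<dots> = (\<Sum>\<sigma>\<in>?T. \<Sum>\<eta> | \<eta> \<in> ?E \<and> ?s \<eta> = \<sigma>. ?M \<eta> * ?g (?s \<eta>))"
    by (rule sum.group[OF finE finT, symmetric]) auto
  also have "\<dots> = (\<Sum>\<sigma>\<in>?T. sign_weight hs vs adm wt sg N A \<sigma> * ?g \<sigma>)"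
  proof (rule sum.cong[OF refl])
    fix \<sigma> assume \<sigma>: "\<sigma> \<in> ?T"
    \<comment> \<open>The conditions at both ends follow from \<open>\<sigma> N = Plus\<close> and
      \<open>\<sigma> 0 = Minus\<close>, so the fibre is a full product.\<close>
    have "{\<eta>. \<eta> \<in> ?E \<and> ?s \<eta> = \<sigma>} = (\<Pi>\<^sub>E k\<in>{..N}. {x \<in> hs. sg x = \<sigma> k})"
      using \<sigma> by (auto simp: PiE_iff fun_eq_iff extensional_def)
    then show "(\<Sum>\<eta> | \<eta> \<in> ?E \<and> ?s \<eta> = \<sigma>. ?M \<eta> * ?g (?s \<eta>)) = sign_weight hs vs adm wt sg N A \<sigma> * ?g \<sigma>"
      unfolding sign_weight_def sum_distrib_right by (intro sum.cong) auto
  qed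
  finally show ?thesis .
qed

text \<open>The total weight of the \<open>n\<close> rightmost columns with left spin
  \<open>x\<close>, where \<open>m k x y\<close> is the weight of column \<open>k\<close> with left
  spin \<open>x\<close> and right spin \<open>y\<close>.\<close>

primrec chain_sum :: "(nat \<Rightarrow> 'h set) \<Rightarrow> (nat \<Rightarrow> 'h \<Rightarrow> 'h \<Rightarrow> 'a::comm_ring_1) \<Rightarrow> nat \<Rightarrow> 'h \<Rightarrow> 'a" where
  "chain_sum X m 0 x = 1"
| "chain_sum X m (Suc n) x = (\<Sum>y\<in>X n. m n x y * chain_sum X m n y)"

text \<open>The induction absorbs the leftmost edge into \<open>f\<close>.\<close>

lemma sum_PiE_chain:
  assumes "\<And>k. finite (X k)"
  shows "(\<Sum>h\<in>PiE {..n} X. (\<Prod>k<n. m k (h (Suc k)) (h k)) * f (h n)) = (\<Sum>x\<in>X n. f x * chain_sum X m n x)"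
proof (induction n arbitrary: f)
  case 0
  have "PiE {..0} X = (\<lambda>x. \<lambda>k\<in>{0}. x) ` X 0"
    by (rule set_eqI) (auto simp: PiE_iff image_iff fun_eq_iff extensional_def restrict_def)
  moreover have "inj_on (\<lambda>x. \<lambda>k\<in>{0::nat}. x) (X 0)"
    by (rule inj_onI) (metis restrict_apply singletonI)
  ultimately show ?case by (simp add: sum.reindex)
next
  case (Suc n)
  have "(\<Sum>h\<in>PiE {..Suc n} X. (\<Prod>k<Suc n. m k (h (Suc k)) (h k)) * f (h (Suc n))) =
      (\<Sum>h\<in>PiE {..n} X. (\<Prod>k<n. m k (h (Suc k)) (h k)) * (\<Sum>x\<in>X (Suc n). m n x (h n) * f x))"
    by (subst sum_PiE_atMost_Suc) (auto simp: assms sum_distrib_left mult.assoc intro!: sum.cong prod.cong)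
  also have "\<dots> = (\<Sum>y\<in>X n. (\<Sum>x\<in>X (Suc n). m n x y * f x) * chain_sum X m n y)"
    by (rule Suc)
  also have "\<dots> = (\<Sum>x\<in>X (Suc n). f x * chain_sum X m (Suc n) x)"
    unfolding sum_distrib_left sum_distrib_right chain_sum.simps
    by (subst sum.swap) (simp add: mult_ac)
  finally show ?case .
qed

section \<open>Signs and boson numbers\<close>

fun hsign :: "hspin \<Rightarrow> sign" where
  "hsign (Color a) = Minus"
| "hsign (Dolor a) = Plus"

definition boson_count :: "nat \<Rightarrow> (nat \<times> nat \<Rightarrow> nat) \<Rightarrow> nat" where
  "boson_count r B = (\<Sum>p\<in>{1..r} \<times> {1..r}. B p)"

text \<open>This is \<open>fused_charge\<close> for the indicator of colors, under which every boson
  has charge 1.\<close>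

lemma boson_count_lower:
  assumes "fused_adm r x A y B"
  shows "boson_count r B = column_count (hsign x) (boson_count r A) (hsign y)"
proof -
  have "int (boson_count r B) + of_bool (hsign y = Minus) = int (boson_count r A) + of_bool (hsign x = Minus)"
    using fused_charge[OF assms, of "\<lambda>x. of_bool (hsign x = Minus)"] by (simp add: boson_count_def)
  then have "boson_count r B + of_bool (hsign y = Minus) = boson_count r A + of_bool (hsign x = Minus)"
    by (auto split: if_splits)
  then show ?thesis by (simp add: column_count_def)
qed

lemma uncol_adm_lower: "uncol_adm \<sigma> n \<sigma>' m \<Longrightarrow> m = column_count \<sigma> n \<sigma>'"
  by (auto simp: uncol_adm_def column_count_def)

lemma finite_uncol_lowers: "finite {m. uncol_adm \<sigma> n \<sigma>' m}"
  by (rule finite_subset[of _ "{column_count \<sigma> n \<sigma>'}"]) (use uncol_adm_lower in auto)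

lemma sum_uncol_weight:
  "(\<Sum>m | uncol_adm \<sigma> n \<sigma>' m. uncol_weight t z \<sigma> n \<sigma>' m) =
    (case (\<sigma>, \<sigma>') of (Plus, Plus) \<Rightarrow> 1 | (Minus, Minus) \<Rightarrow> z
      | (Plus, Minus) \<Rightarrow> t_number t n | (Minus, Plus) \<Rightarrow> (1 - t) * z)"
proof -
  \<comment> \<open>In the exceptional empty case the formula also gives 0, as
    \<open>t_number t 0 = 0\<close>.\<close>
  have "{m. uncol_adm \<sigma> n \<sigma>' m} = (if n = 0 \<and> \<sigma> = Plus \<and> \<sigma>' = Minus then {} else {column_count \<sigma> n \<sigma>'})"
    by (cases \<sigma>; cases \<sigma>') (auto simp: uncol_adm_def column_count_def)
  then show ?thesis
    by (cases \<sigma>; cases \<sigma>') (auto simp: uncol_weight_def uncol_adm_def column_count_def)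
qed

lemma sign_weight_uncol:
  assumes "\<sigma> \<in> {..N} \<rightarrow>\<^sub>E UNIV"
  shows "sign_weight UNIV UNIV uncol_adm (uncol_weight t z) id N A \<sigma> =
    (\<Prod>k<N. \<Sum>m | uncol_adm (\<sigma> (Suc k)) (A k) (\<sigma> k) m. uncol_weight t z (\<sigma> (Suc k)) (A k) (\<sigma> k) m)"
proof -
  have "(\<Pi>\<^sub>E k\<in>{..N}. {x \<in> UNIV. id x = \<sigma> k}) = {\<sigma>}"
    using assms PiE_singleton[of \<sigma> "{..N}"] by (simp add: PiE_iff)
  then show ?thesis by (simp add: sign_weight_def)
qed

text \<open>By \<open>fused_lump\<close>, each column acts on the pair (common value on colors, sum
  over dolors) as \<open>z ^ (r - 1)\<close> times the uncolored column; the signs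
  \<open>\<sigma>\<close> select which component survives at each edge.\<close>

lemma sign_weight_bicol:
  assumes "r \<ge> 1" and \<sigma>: "\<sigma> \<in> {..N} \<rightarrow>\<^sub>E UNIV" "\<sigma> N = Plus" "\<sigma> 0 = Minus"
  shows "sign_weight (hspins r) (boson_spins r) (fused_adm r) (fused_weight r t z) hsign N A \<sigma> =
    z ^ (N * (r - 1)) * sign_weight UNIV UNIV uncol_adm (uncol_weight t z) id N (\<lambda>k. boson_count r (A k)) \<sigma>"
proof -
  let ?X = "\<lambda>k. {x \<in> hspins r. hsign x = \<sigma> k}"
  let ?m = "\<lambda>k x y. \<Sum>B | B \<in> boson_spins r \<and> fused_adm r x (A k) y B. fused_weight r t z x (A k) y B"
  let ?R = "chain_sum ?X ?m"
  let ?n = "\<lambda>k. boson_count r (A k)"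
  let ?u = "\<lambda>k. \<Sum>b | uncol_adm (\<sigma> (Suc k)) (?n k) (\<sigma> k) b. uncol_weight t z (\<sigma> (Suc k)) (?n k) (\<sigma> k) b"
  let ?U = "\<lambda>n. z ^ (n * (r - 1)) * (\<Prod>k<n. ?u k)"
  \<comment> \<open>The extra \<open>z\<close> of an incoming color is the factor \<open>z\<close>
    of an uncolored vertex with left spin \<open>Minus\<close>.\<close>
  have zr: "z ^ r = z ^ (r - 1) * z"
    using \<open>r \<ge> 1\<close> by (metis One_nat_def Suc_pred less_eq_Suc_le mult.commute power_Suc)
  have lump: "(\<sigma> n = Minus \<longrightarrow> (\<forall>a\<in>{1..r}. ?R n (Color a) = ?U n)) \<and>
      (\<sigma> n = Plus \<longrightarrow> (\<Sum>a\<in>{1..r}. ?R n (Dolor a)) = ?U n)" for n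
  proof (induction n)
    case 0
    \<comment> \<open>The right end is a color, where the empty chain is constantly 1; its sum over
      the dolors would be \<open>r\<close>.\<close>
    then show ?case using \<sigma> by simp
  next
    case (Suc n)
    \<comment> \<open>Setting the function to 0 on spins of the wrong sign fits it to
      \<open>fused_lump\<close>, with either \<open>\<kappa>\<close> or the dolor sum equal to
      0.\<close>
    let ?f = "\<lambda>x. if hsign x = \<sigma> n then ?R n x else 0"
    have R: "?R (Suc n) x = foldr (label_step r t z (A n)) (labels r) ?f x" if "x \<in> hspins r" for x
    proof -
      have "?R (Suc n) x = (\<Sum>y\<in>hspins r. ?m n x y * ?f y)"
        by (simp add: sum.inter_filter[OF finite_hspins] if_distrib cong: if_cong)
      then show ?thesis using sum_fused_weight[OF that] by simp
    qed
    let ?\<kappa> = "if \<sigma> n = Minus then ?U n else 0"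
    let ?S = "if \<sigma> n = Plus then ?U n else 0"
    have f: "?f (Color a) = ?\<kappa>" if "a \<in> {1..r}" for a
      using Suc that by simp
    have S: "(\<Sum>x\<in>{1..r}. ?f (Dolor x)) = ?S"
      using Suc by (cases "\<sigma> n") simp_all
    note L = fused_lump[where r = r and f = ?f and \<kappa> = ?\<kappa> and t = t and z = z and A = "A n",
        OF f, unfolded S]
    have col: "?R (Suc n) (Color a) = z ^ r * (?\<kappa> + (1 - t) * ?S)" if "a \<in> {1..r}" for a
      using L(1)[OF _ that] R that by (simp del: chain_sum.simps)
    have dol: "(\<Sum>x\<in>{1..r}. ?R (Suc n) (Dolor x)) = z ^ (r - 1) * (?S + t_number t (?n n) * ?\<kappa>)"
      using L(2) R by (simp add: boson_count_def del: chain_sum.simps)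
    have U: "?U (Suc n) = z ^ (r - 1) * ?u n * ?U n"
      by (simp only: mult_Suc power_add prod.lessThan_Suc mult_ac)
    show ?case
    proof (intro conjI impI ballI)
      fix a assume "\<sigma> (Suc n) = Minus" "a \<in> {1..r}"
      then show "?R (Suc n) (Color a) = ?U (Suc n)"
        unfolding U col[OF \<open>a \<in> {1..r}\<close>] zr by (cases "\<sigma> n") (simp_all add: sum_uncol_weight mult_ac)
    next
      assume "\<sigma> (Suc n) = Plus"
      then show "(\<Sum>a\<in>{1..r}. ?R (Suc n) (Dolor a)) = ?U (Suc n)"
        unfolding U dol by (cases "\<sigma> n") (simp_all add: sum_uncol_weight mult_ac)
    qed
  qed
  have "sign_weight (hspins r) (boson_spins r) (fused_adm r) (fused_weight r t z) hsign N A \<sigma> =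
      (\<Sum>x\<in>?X N. ?R N x)"
    unfolding sign_weight_def
    using sum_PiE_chain[where X = ?X and n = N and m = ?m and f = "\<lambda>_. 1"] by (simp add: finite_hspins)
  also have "\<dots> = (\<Sum>x\<in>{1..r}. ?R N (Dolor x))"
    using \<sigma>(2) by (simp add: sum.inter_filter[OF finite_hspins] sum_hspins)
  also have "\<dots> = ?U N" using lump \<sigma>(2) by blast
  finally show ?thesis unfolding sign_weight_uncol[OF \<sigma>(1)] .
qed

text \<open>Both row sums expand over the same sign patterns with the same values of
  \<open>g\<close>, so only the weights of the patterns have to be compared.\<close>

lemma row_lump:
  assumes "r \<ge> 1"
  shows "row_sum N (hspins r) (boson_spins r) (fused_adm r)
        {x \<in> hspins r. hsign x = Plus} {x \<in> hspins r. hsign x = Minus} (fused_weight r t z)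
        (\<lambda>B. g (\<lambda>k\<in>{..<N}. boson_count r (B k))) A =
    z ^ (N * (r - 1)) * row_sum N UNIV UNIV uncol_adm {Plus} {Minus} (uncol_weight t z)
        (\<lambda>B. g (restrict B {..<N})) (\<lambda>k. boson_count r (A k))"
proof -
  have bicol: "row_sum N (hspins r) (boson_spins r) (fused_adm r)
        {x \<in> hspins r. hsign x = Plus} {x \<in> hspins r. hsign x = Minus} (fused_weight r t z)
        (\<lambda>B. g (\<lambda>k\<in>{..<N}. boson_count r (B k))) A =
    (\<Sum>\<sigma> | \<sigma> \<in> {..N} \<rightarrow>\<^sub>E UNIV \<and> \<sigma> N = Plus \<and> \<sigma> 0 = Minus.
      sign_weight (hspins r) (boson_spins r) (fused_adm r) (fused_weight r t z) hsign N A \<sigma> *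
      g (\<lambda>k\<in>{..<N}. column_count (\<sigma> (Suc k)) (boson_count r (A k)) (\<sigma> k)))"
    by (rule sum_row_states[OF finite_hspins finite_fused_lower_spins boson_count_lower])
  have uncol: "row_sum N UNIV UNIV uncol_adm {Plus} {Minus} (uncol_weight t z)
        (\<lambda>B. g (restrict B {..<N})) (\<lambda>k. boson_count r (A k)) =
    (\<Sum>\<sigma> | \<sigma> \<in> {..N} \<rightarrow>\<^sub>E UNIV \<and> \<sigma> N = Plus \<and> \<sigma> 0 = Minus.
      sign_weight UNIV UNIV uncol_adm (uncol_weight t z) id N (\<lambda>k. boson_count r (A k)) \<sigma> *
      g (\<lambda>k\<in>{..<N}. column_count (\<sigma> (Suc k)) (boson_count r (A k)) (\<sigma> k)))"
    using sum_row_states[where hs = UNIV and vs = UNIV and adm = uncol_adm and cnt = id and sg = id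
        and N = N and wt = "uncol_weight t z" and A = "\<lambda>k. boson_count r (A k)" and g = g]
      finite_UNIV_sign finite_uncol_lowers
    by (simp add: uncol_adm_lower[symmetric] restrict_def)
  show ?thesis
    unfolding bicol uncol sum_distrib_left
    by (intro sum.cong refl) (simp only: mem_Collect_eq sign_weight_bicol[OF assms] mult.assoc)
qed

section \<open>Forgetting colors and dolors in a grid\<close>

text \<open>
  The lower boundary is left free, so that states can be built up row by row from the top.
\<close>

definition free_states ::
  "nat \<Rightarrow> nat \<Rightarrow> 'h set \<Rightarrow> 'v set \<Rightarrow> ('h \<Rightarrow> 'v \<Rightarrow> 'h \<Rightarrow> 'v \<Rightarrow> bool) \<Rightarrow> 'h set \<Rightarrow> 'h set \<Rightarrow>
   (nat \<Rightarrow> 'v) \<Rightarrow> ((nat \<times> nat \<Rightarrow> 'h) \<times> (nat \<times> nat \<Rightarrow> 'v)) set"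
where
  "free_states n N hs vs adm Ls Rs upper =
    {(H, V). H \<in> {1..n} \<times> {..N} \<rightarrow>\<^sub>E hs \<and> V \<in> {..n} \<times> {..<N} \<rightarrow>\<^sub>E vs \<and>
       (\<forall>i\<in>{1..n}. H (i, N) \<in> Ls \<and> H (i, 0) \<in> Rs) \<and> (\<forall>k<N. V (0, k) = upper k) \<and>
       (\<forall>i\<in>{1..n}. \<forall>k<N. adm (H (i, Suc k)) (V (i - 1, k)) (H (i, k)) (V (i, k)))}"

definition row_of :: "nat \<Rightarrow> nat \<Rightarrow> (nat \<times> nat \<Rightarrow> 'v) \<Rightarrow> nat \<Rightarrow> 'v" where
  "row_of n N V = (\<lambda>k\<in>{..<N}. V (n, k))"

lemma free_states_0:
  fixes upper :: "nat \<Rightarrow> 'a"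
  assumes "\<And>k. k < N \<Longrightarrow> upper k \<in> vs"
  shows "free_states 0 N hs vs adm Ls Rs upper =
    {(\<lambda>x. undefined, \<lambda>x\<in>{..0} \<times> {..<N}. upper (snd x))}"
proof -
  have "V \<in> {..0} \<times> {..<N} \<rightarrow>\<^sub>E vs \<and> (\<forall>k<N. V (0, k) = upper k) \<longleftrightarrow>
      V = (\<lambda>x\<in>{..0} \<times> {..<N}. upper (snd x))" for V :: "nat \<times> nat \<Rightarrow> 'a"
    using assms by (auto simp: PiE_iff fun_eq_iff extensional_def)
  then show ?thesis
    unfolding free_states_def by (auto simp: set_eq_iff)
qed

lemma row_states_iff:
  "(\<eta>, B) \<in> row_states N hs vs adm Ls Rs A \<longleftrightarrow>
    \<eta> \<in> {..N} \<rightarrow>\<^sub>E hs \<and> \<eta> N \<in> Ls \<and> \<eta> 0 \<in> Rs \<and> B \<in> {..<N} \<rightarrow>\<^sub>E vs \<and>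
    (\<forall>k<N. adm (\<eta> (Suc k)) (A k) (\<eta> k) (B k))"
  by (auto simp: row_states_def PiE_iff)

text \<open>A new bottom row is attached along the lower boundary \<open>row_of n N V\<close>. The
  inverse restricts to the first \<open>n\<close> rows and reads off the last one; extensionality
  makes the two maps mutually inverse.\<close>

lemma bij_free_states_Suc:
  "bij_betw (\<lambda>((H, V), (\<eta>, B)). (\<lambda>(i, k)\<in>{1..Suc n} \<times> {..N}. if i = Suc n then \<eta> k else H (i, k),
       \<lambda>(i, k)\<in>{..Suc n} \<times> {..<N}. if i = Suc n then B k else V (i, k)))
     (SIGMA s:free_states n N hs vs adm Ls Rs upper. row_states N hs vs adm Ls Rs (row_of n N (snd s)))
     (free_states (Suc n) N hs vs adm Ls Rs upper)"
    (is "bij_betw ?f ?A ?B")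
proof (rule bij_betw_byWitness[where f' = "\<lambda>(H, V).
    ((restrict H ({1..n} \<times> {..N}), restrict V ({..n} \<times> {..<N})), (\<lambda>k\<in>{..N}. H (Suc n, k), row_of (Suc n) N V))"];
    (intro ballI subsetI; (elim imageE)?)?)
  fix a assume a: "a \<in> ?A"
  obtain H V \<eta> B where a_eq: "a = ((H, V), (\<eta>, B))" by (metis surj_pair)
  have a1: "(H, V) \<in> free_states n N hs vs adm Ls Rs upper"
    and a2: "(\<eta>, B) \<in> row_states N hs vs adm Ls Rs (row_of n N V)"
    using a unfolding a_eq by simp_all
  have H: "H \<in> {1..n} \<times> {..N} \<rightarrow>\<^sub>E hs" and V: "V \<in> {..n} \<times> {..<N} \<rightarrow>\<^sub>E vs"
    and \<eta>: "\<eta> \<in> {..N} \<rightarrow>\<^sub>E hs" and B: "B \<in> {..<N} \<rightarrow>\<^sub>E vs"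
    using a1 a2 by (simp_all add: free_states_def row_states_iff)
  show "(\<lambda>(H, V). ((restrict H ({1..n} \<times> {..N}), restrict V ({..n} \<times> {..<N})),
      (\<lambda>k\<in>{..N}. H (Suc n, k), row_of (Suc n) N V))) (?f a) = a"
    using H V \<eta> B unfolding a_eq row_of_def
    by (auto simp: fun_eq_iff PiE_iff extensional_def restrict_def)
next
  fix b assume b: "b \<in> ?B"
  obtain H V where b_eq: "b = (H, V)" by (metis surj_pair)
  have H: "H \<in> {1..Suc n} \<times> {..N} \<rightarrow>\<^sub>E hs" and V: "V \<in> {..Suc n} \<times> {..<N} \<rightarrow>\<^sub>E vs"
    using b unfolding b_eq free_states_def by auto
  show "?f ((\<lambda>(H, V). ((restrict H ({1..n} \<times> {..N}), restrict V ({..n} \<times> {..<N})),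
      (\<lambda>k\<in>{..N}. H (Suc n, k), row_of (Suc n) N V))) b) = b"
    using H V unfolding b_eq row_of_def
    by (auto simp: fun_eq_iff PiE_iff extensional_def restrict_def le_Suc_eq)
next
  fix b a assume b_eq: "b = ?f a" and a: "a \<in> ?A"
  obtain H V \<eta> B where a_eq: "a = ((H, V), (\<eta>, B))" by (metis surj_pair)
  have a1: "(H, V) \<in> free_states n N hs vs adm Ls Rs upper"
    and a2: "(\<eta>, B) \<in> row_states N hs vs adm Ls Rs (row_of n N V)"
    using a unfolding a_eq by simp_all
  show "b \<in> ?B"
    using a1 a2 unfolding b_eq a_eq
    by (auto simp: free_states_def row_states_iff row_of_def PiE_iff le_Suc_eq)
next
  fix a b assume a_eq: "a = (\<lambda>(H, V). ((restrict H ({1..n} \<times> {..N}), restrict V ({..n} \<times> {..<N})),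
      (\<lambda>k\<in>{..N}. H (Suc n, k), row_of (Suc n) N V))) b" and b: "b \<in> ?B"
  obtain H V where b_eq: "b = (H, V)" by (metis surj_pair)
  show "a \<in> ?A"
    using b unfolding a_eq b_eq
    by (auto simp: free_states_def row_states_iff row_of_def PiE_iff dest: bspec[of _ _ "Suc n"])
qed

definition state_weight ::
  "nat \<Rightarrow> nat \<Rightarrow> ('a::comm_ring_1 \<Rightarrow> 'h \<Rightarrow> 'v \<Rightarrow> 'h \<Rightarrow> 'v \<Rightarrow> 'a) \<Rightarrow> (nat \<Rightarrow> 'a) \<Rightarrow>
   (nat \<times> nat \<Rightarrow> 'h) \<times> (nat \<times> nat \<Rightarrow> 'v) \<Rightarrow> 'a"
where
  "state_weight n N wt z s =
    (\<Prod>i\<in>{1..n}. \<Prod>k<N. wt (z i) (fst s (i, Suc k)) (snd s (i - 1, k)) (fst s (i, k)) (snd s (i, k)))"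

lemma finite_free_states:
  assumes "finite hs" "\<And>x u y. finite {b \<in> vs. adm x u y b}" "\<And>k. k < N \<Longrightarrow> upper k \<in> vs"
  shows "finite (free_states n N hs vs adm Ls Rs upper)"
proof (induction n)
  case 0
  show ?case by (subst free_states_0) (use assms(3) in auto)
next
  case (Suc n)
  then show ?case
    by (subst bij_betw_finite[OF bij_free_states_Suc, symmetric])
      (intro finite_SigmaI finite_row_states assms)
qed

text \<open>Summing out the bottom row replaces the function \<open>g\<close> of the lower boundary
  by its image under the row transfer operator.\<close>

lemma sum_free_states_Suc:
  assumes "finite hs" "\<And>x u y. finite {b \<in> vs. adm x u y b}" "\<And>k. k < N \<Longrightarrow> upper k \<in> vs"
  shows "(\<Sum>s\<in>free_states (Suc n) N hs vs adm Ls Rs upper.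
      state_weight (Suc n) N wt z s * g (row_of (Suc n) N (snd s))) =
    (\<Sum>s\<in>free_states n N hs vs adm Ls Rs upper.
      state_weight n N wt z s * row_sum N hs vs adm Ls Rs (wt (z (Suc n))) g (row_of n N (snd s)))"
proof -
  let ?F = "free_states n N hs vs adm Ls Rs upper"
  let ?R = "\<lambda>s. row_states N hs vs adm Ls Rs (row_of n N (snd s))"
  let ?f = "\<lambda>((H, V), (\<eta>, B)). (\<lambda>(i, k)\<in>{1..Suc n} \<times> {..N}. if i = Suc n then \<eta> k else H (i, k),
       \<lambda>(i, k)\<in>{..Suc n} \<times> {..<N}. if i = Suc n then B k else V (i, k))"
  let ?w = "\<lambda>s \<rho>. \<Prod>k<N. wt (z (Suc n)) (fst \<rho> (Suc k)) (row_of n N (snd s) k) (fst \<rho> k) (snd \<rho> k)"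
  have split: "state_weight (Suc n) N wt z (?f (s, \<rho>)) * g (row_of (Suc n) N (snd (?f (s, \<rho>)))) =
      state_weight n N wt z s * (?w s \<rho> * g (snd \<rho>))" if "\<rho> \<in> ?R s" for s \<rho>
  proof -
    obtain H V \<eta> B where eq: "s = (H, V)" "\<rho> = (\<eta>, B)" by (metis surj_pair)
    have B: "B \<in> {..<N} \<rightarrow>\<^sub>E vs" using that by (simp add: eq row_states_iff)
    have "row_of (Suc n) N (snd (?f (s, \<rho>))) = B"
      using B by (auto simp: eq row_of_def fun_eq_iff PiE_iff extensional_def)
    moreover have "state_weight (Suc n) N wt z (?f (s, \<rho>)) = state_weight n N wt z s * ?w s \<rho>"
    proof -
      have "(\<Prod>i\<in>{1..n}. \<Prod>k<N. wt (z i) (fst (?f (s, \<rho>)) (i, Suc k)) (snd (?f (s, \<rho>)) (i - 1, k))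
          (fst (?f (s, \<rho>)) (i, k)) (snd (?f (s, \<rho>)) (i, k))) = state_weight n N wt z s"
        unfolding state_weight_def eq by (intro prod.cong refl) auto
      moreover have "(\<Prod>k<N. wt (z (Suc n)) (fst (?f (s, \<rho>)) (Suc n, Suc k)) (snd (?f (s, \<rho>)) (Suc n - 1, k))
          (fst (?f (s, \<rho>)) (Suc n, k)) (snd (?f (s, \<rho>)) (Suc n, k))) = ?w s \<rho>"
        unfolding eq by (intro prod.cong refl) (auto simp: row_of_def)
      ultimately show ?thesis
        unfolding state_weight_def[of "Suc n"] by (simp only: prod.nat_ivl_Suc' le_add1 One_nat_def Suc_le_mono le0 mult.commute)
    qed
    ultimately show ?thesis by (simp only: eq snd_conv mult.assoc)
  qed
  have "(\<Sum>s\<in>free_states (Suc n) N hs vs adm Ls Rs upper.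
      state_weight (Suc n) N wt z s * g (row_of (Suc n) N (snd s))) =
      (\<Sum>p\<in>(SIGMA s:?F. ?R s). state_weight (Suc n) N wt z (?f p) * g (row_of (Suc n) N (snd (?f p))))"
    by (rule sum.reindex_bij_betw[OF bij_free_states_Suc, symmetric])
  also have "\<dots> = (\<Sum>p\<in>(SIGMA s:?F. ?R s). case p of (s, \<rho>) \<Rightarrow> state_weight n N wt z s * (?w s \<rho> * g (snd \<rho>)))"
    by (rule sum.cong[OF refl]) (use split in fast)
  also have "\<dots> = (\<Sum>s\<in>?F. \<Sum>\<rho>\<in>?R s. state_weight n N wt z s * (?w s \<rho> * g (snd \<rho>)))"
    by (rule sum.Sigma[symmetric]) (use assms in \<open>auto intro!: finite_free_states finite_row_states\<close>)
  finally show ?thesis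
    by (simp add: row_sum_def sum_distrib_left case_prod_beta)
qed

lemma row_sum_cong:
  assumes "\<And>k. k < N \<Longrightarrow> A k = A' k"
    and "\<And>B. B \<in> {..<N} \<rightarrow>\<^sub>E vs \<Longrightarrow> g B = g' B"
  shows "row_sum N hs vs adm Ls Rs wt g A = row_sum N hs vs adm Ls Rs wt g' A'"
  unfolding row_sum_def
  by (rule sum.cong) (auto simp: row_states_iff assms cong: conj_cong)

section \<open>Comparison of bicolored and uncolored grids\<close>

definition free_bicol_states where
  "free_bicol_states r n N upper = free_states n N (hspins r) (boson_spins r) (fused_adm r)
     {x \<in> hspins r. hsign x = Plus} {x \<in> hspins r. hsign x = Minus} upper"

definition free_uncol_states where
  "free_uncol_states n N upper = free_states n N UNIV UNIV uncol_adm {Plus} {Minus} upper"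

text \<open>The lower boundary is observed only through its boson numbers. By
  \<open>row_lump\<close>, summing out the bottom row yields an observable of the same kind one row
  higher, so the induction runs over all \<open>g\<close>.\<close>

lemma states_lump:
  fixes t :: "'a::comm_ring_1"
  assumes "r \<ge> 1" and upper: "\<And>k. k < N \<Longrightarrow> upper k \<in> boson_spins r"
  shows "(\<Sum>s\<in>free_bicol_states r n N upper. state_weight n N (fused_weight r t) z s *
      g (\<lambda>k\<in>{..<N}. boson_count r (row_of n N (snd s) k))) =
    (\<Prod>i\<in>{1..n}. z i ^ (N * (r - 1))) *
    (\<Sum>s\<in>free_uncol_states n N (\<lambda>k. boson_count r (upper k)).
      state_weight n N (uncol_weight t) z s * g (row_of n N (snd s)))"
  unfolding free_bicol_states_def free_uncol_states_def
proof (induction n arbitrary: g)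
  case 0
  show ?case
    using upper
    by (simp add: free_states_0 state_weight_def)
      (rule arg_cong[of _ _ g], simp add: row_of_def restrict_def fun_eq_iff)
next
  case (Suc n)
  let ?zz = "z (Suc n) ^ (N * (r - 1))"
  let ?G = "row_sum N UNIV UNIV uncol_adm {Plus} {Minus} (uncol_weight t (z (Suc n))) g"
  \<comment> \<open>This adjusts \<open>row_lump\<close> by restrictions: a row sum reads the upper
    boundary in columns below \<open>N\<close> only, and its lower boundaries are
    extensional.\<close>
  have row: "row_sum N (hspins r) (boson_spins r) (fused_adm r)
        {x \<in> hspins r. hsign x = Plus} {x \<in> hspins r. hsign x = Minus} (fused_weight r t (z (Suc n)))
        (\<lambda>B. g (\<lambda>k\<in>{..<N}. boson_count r (B k))) A =
      ?zz * ?G (\<lambda>k\<in>{..<N}. boson_count r (A k))" for A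
    unfolding row_lump[OF assms(1)]
    by (intro arg_cong2[of _ _ _ _ "(*)"] refl row_sum_cong)
      (auto simp: PiE_def extensional_restrict)
  have "(\<Sum>s\<in>free_states (Suc n) N (hspins r) (boson_spins r) (fused_adm r)
       {x \<in> hspins r. hsign x = Plus} {x \<in> hspins r. hsign x = Minus} upper.
       state_weight (Suc n) N (fused_weight r t) z s *
       g (\<lambda>k\<in>{..<N}. boson_count r (row_of (Suc n) N (snd s) k))) =
      (\<Sum>s\<in>free_states n N (hspins r) (boson_spins r) (fused_adm r)
       {x \<in> hspins r. hsign x = Plus} {x \<in> hspins r. hsign x = Minus} upper.
       state_weight n N (fused_weight r t) z s *
       (?zz * ?G (\<lambda>k\<in>{..<N}. boson_count r (row_of n N (snd s) k))))"
    by (subst sum_free_states_Suc[OF finite_hspins finite_fused_lower_spins upper,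
          where g = "\<lambda>B. g (\<lambda>k\<in>{..<N}. boson_count r (B k))"]) (simp_all only: row)
  also have "\<dots> = (\<Prod>i\<in>{1..Suc n}. z i ^ (N * (r - 1))) *
    (\<Sum>s\<in>free_states n N UNIV UNIV uncol_adm {Plus} {Minus} (\<lambda>k. boson_count r (upper k)).
      state_weight n N (uncol_weight t) z s * ?G (row_of n N (snd s)))"
    \<comment> \<open>The factor of the last row travels through the induction hypothesis as part of
      the observable.\<close>
    unfolding Suc[of "\<lambda>B. ?zz * ?G B"] by (simp add: sum_distrib_left mult_ac)
  also have "(\<Sum>s\<in>free_states n N UNIV UNIV uncol_adm {Plus} {Minus} (\<lambda>k. boson_count r (upper k)).
      state_weight n N (uncol_weight t) z s * ?G (row_of n N (snd s))) =
    (\<Sum>s\<in>free_states (Suc n) N UNIV UNIV uncol_adm {Plus} {Minus} (\<lambda>k. boson_count r (upper k)).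
      state_weight (Suc n) N (uncol_weight t) z s * g (row_of (Suc n) N (snd s)))"
    by (rule sum_free_states_Suc[symmetric]) (simp_all add: finite_UNIV_sign finite_uncol_lowers)
  finally show ?case .
qed

text \<open>The empty lower boundary becomes an indicator function, as \<open>states_lump\<close>
  requires.\<close>

lemma Z_uncol_free:
  "Z_uncol r N t lam z =
    (\<Sum>s\<in>free_uncol_states r N (\<lambda>k. card {i \<in> {1..r}. lam i = k}).
      state_weight r N (uncol_weight t) z s * of_bool (row_of r N (snd s) = (\<lambda>k\<in>{..<N}. 0)))"
proof -
  have "uncol_states r N lam = {s \<in> free_uncol_states r N (\<lambda>k. card {i \<in> {1..r}. lam i = k}).
      row_of r N (snd s) = (\<lambda>k\<in>{..<N}. 0)}"
    unfolding uncol_states_def lattice_states_def free_uncol_states_def free_states_def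
    by (auto simp: row_of_def fun_eq_iff)
  moreover have "finite (free_uncol_states r N (\<lambda>k. card {i \<in> {1..r}. lam i = k}))"
    unfolding free_uncol_states_def
    by (rule finite_free_states) (simp_all add: finite_UNIV_sign finite_uncol_lowers)
  ultimately show ?thesis
    by (simp add: Z_uncol_def partition_function_def state_weight_def case_prod_beta Int_def)
qed

text \<open>When the charge balances of all vertices are added, horizontal charges telescope along
  each row and vertical ones down the grid; only the boundary remains.\<close>

lemma bicol_charge:
  fixes q :: "hspin \<Rightarrow> int"
  assumes s: "(H, V) \<in> free_bicol_states r n N upper"
  defines "E \<equiv> \<lambda>B. \<Sum>p\<in>{1..r} \<times> {1..r}. (q (Color (fst p)) - q (Dolor (snd p))) * int (B p)"
  shows "(\<Sum>k<N. E (V (n, k))) + (\<Sum>i\<in>{1..n}. q (H (i, 0))) =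
    (\<Sum>k<N. E (upper k)) + (\<Sum>i\<in>{1..n}. q (H (i, N)))"
proof -
  have adm: "fused_adm r (H (i, Suc k)) (V (i - 1, k)) (H (i, k)) (V (i, k))"
    if "i \<in> {1..n}" "k < N" for i k
    using s that by (auto simp: free_bicol_states_def free_states_def)
  have row: "(\<Sum>k<M. E (V (i, k))) + q (H (i, 0)) = (\<Sum>k<M. E (V (i - 1, k))) + q (H (i, M))"
    if i: "i \<in> {1..n}" and "M \<le> N" for i M
    using \<open>M \<le> N\<close>
  proof (induction M)
    case (Suc M)
    then show ?case
      using fused_charge[OF adm[OF i, of M], of q] by (simp add: E_def)
  qed simp
  have "(\<Sum>k<N. E (V (m, k))) + (\<Sum>i\<in>{1..m}. q (H (i, 0))) =
    (\<Sum>k<N. E (V (0, k))) + (\<Sum>i\<in>{1..m}. q (H (i, N)))" if "m \<le> n" for m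
    using that
  proof (induction m)
    case (Suc m)
    then show ?case using row[of "Suc m" N] by simp
  qed simp
  moreover have "V (0, k) = upper k" if "k < N" for k
    using s that by (auto simp: free_bicol_states_def free_states_def)
  ultimately show ?thesis by simp
qed

text \<open>Double counting: a sum over kinds \<open>p\<close> with multiplicities is a sum over the
  single bosons \<open>i\<close>.\<close>

lemma sum_card_fibers:
  fixes f :: "'p \<Rightarrow> int"
  assumes "finite I" "finite P" "\<And>i. i \<in> I \<Longrightarrow> \<pi> i \<in> P"
  shows "(\<Sum>p\<in>P. f p * int (card {i \<in> I. Q i \<and> p = \<pi> i})) = (\<Sum>i\<in>I. if Q i then f (\<pi> i) else 0)"
proof -
  have "int (card {i \<in> I. Q i \<and> p = \<pi> i}) = (\<Sum>i\<in>I. if p = \<pi> i then of_bool (Q i) else 0)" for p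
  proof -
    have "(\<Sum>i\<in>I. if p = \<pi> i then of_bool (Q i) else 0) = (\<Sum>i\<in>I. of_bool (Q i \<and> p = \<pi> i) :: int)"
      by (intro sum.cong) auto
    also have "\<dots> = int (card (I \<inter> {i. Q i \<and> p = \<pi> i}))"
      using assms(1) by simp
    finally show ?thesis by (simp add: Int_def)
  qed
  then have "(\<Sum>p\<in>P. f p * int (card {i \<in> I. Q i \<and> p = \<pi> i})) =
      (\<Sum>p\<in>P. \<Sum>i\<in>I. if p = \<pi> i then f p * of_bool (Q i) else 0)"
    by (simp add: sum_distrib_left if_distrib cong: if_cong)
  also have "\<dots> = (\<Sum>i\<in>I. \<Sum>p\<in>P. if p = \<pi> i then f p * of_bool (Q i) else 0)"
    by (rule sum.swap)
  also have "\<dots> = (\<Sum>i\<in>I. if Q i then f (\<pi> i) else 0)"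
    using assms by (intro sum.cong refl) simp
  finally show ?thesis .
qed

section \<open>Boundary permutations\<close>

lemma bicol_top_pair:
  assumes "w3 permutes {1..r}" "w4 permutes {1..r}" "i \<in> {1..r}"
  shows "(inv w3 i, (inv w4 \<circ> long_element r) i) \<in> {1..r} \<times> {1..r}"
proof -
  have "long_element r i \<in> {1..r}" using assms(3) by (auto simp: long_element_def)
  then show ?thesis
    using assms permutes_in_image[OF permutes_inv] by (metis comp_apply mem_Sigma_iff)
qed

lemma sum_bicol_top:
  fixes f :: "nat \<times> nat \<Rightarrow> int"
  assumes "w3 permutes {1..r}" "w4 permutes {1..r}"
  shows "(\<Sum>p\<in>{1..r} \<times> {1..r}. f p * int (bicol_top r lam w3 w4 k p)) =
    (\<Sum>i\<in>{1..r}. if lam i = k then f (inv w3 i, (inv w4 \<circ> long_element r) i) else 0)"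
  using sum_card_fibers[of "{1..r}" "{1..r} \<times> {1..r}" "\<lambda>i. (inv w3 i, (inv w4 \<circ> long_element r) i)"
      f "\<lambda>i. lam i = k"] bicol_top_pair[OF assms]
  by (simp add: bicol_top_def cong: sum.cong)

lemma boson_count_bicol_top:
  assumes "w3 permutes {1..r}" "w4 permutes {1..r}"
  shows "boson_count r (bicol_top r lam w3 w4 k) = card {i \<in> {1..r}. lam i = k}"
proof -
  have "int (boson_count r (bicol_top r lam w3 w4 k)) = (\<Sum>i\<in>{1..r}. of_bool (lam i = k))"
    using sum_bicol_top[OF assms, of "\<lambda>_. 1"] by (simp add: boson_count_def of_bool_def)
  also have "\<dots> = int (card ({1..r} \<inter> {i. lam i = k}))"
    by simp
  finally show ?thesis by (simp add: Int_def)
qed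

lemma bij_long_element: "bij_betw (long_element r) {1..r} {1..r}"
  by (rule bij_betw_byWitness[where f' = "long_element r"]) (auto simp: long_element_def)

text \<open>As \<open>inv w3\<close> and \<open>inv w4 \<circ> long_element r\<close> permute
  \<open>{1..r}\<close>, the upper boundary holds each color and each dolor exactly once, so its
  charge does not depend on \<open>w3\<close> and \<open>w4\<close>.\<close>

lemma bicol_boundary_charge:
  fixes q :: "hspin \<Rightarrow> int"
  assumes s: "(H, V) \<in> free_bicol_states r n N (bicol_top r lam w3 w4)"
    and empty: "\<And>k. k < N \<Longrightarrow> V (n, k) = (\<lambda>p\<in>{1..r} \<times> {1..r}. 0)"
    and w: "w3 permutes {1..r}" "w4 permutes {1..r}" and lam: "\<And>i. i \<in> {1..r} \<Longrightarrow> lam i < N"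
  shows "(\<Sum>i\<in>{1..n}. q (H (i, 0))) - (\<Sum>i\<in>{1..n}. q (H (i, N))) =
    (\<Sum>a\<in>{1..r}. q (Color a)) - (\<Sum>a\<in>{1..r}. q (Dolor a))"
proof -
  let ?Q = "\<lambda>p. q (Color (fst p)) - q (Dolor (snd p))"
  let ?\<pi> = "\<lambda>i. (inv w3 i, (inv w4 \<circ> long_element r) i)"
  have "(\<Sum>k<N. \<Sum>p\<in>{1..r} \<times> {1..r}. ?Q p * int (bicol_top r lam w3 w4 k p)) =
      (\<Sum>k<N. \<Sum>i\<in>{1..r}. if lam i = k then ?Q (?\<pi> i) else 0)"
    by (simp only: sum_bicol_top[OF w])
  also have "\<dots> = (\<Sum>i\<in>{1..r}. \<Sum>k<N. if lam i = k then ?Q (?\<pi> i) else 0)"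
    by (rule sum.swap)
  \<comment> \<open>Since \<open>lam i < N\<close>, exactly one column holds boson
    \<open>i\<close>.\<close>
  also have "\<dots> = (\<Sum>i\<in>{1..r}. ?Q (?\<pi> i))"
    using lam by (intro sum.cong refl) simp
  also have "\<dots> = (\<Sum>i\<in>{1..r}. q (Color (inv w3 i))) - (\<Sum>i\<in>{1..r}. q (Dolor ((inv w4 \<circ> long_element r) i)))"
    by (simp add: sum_subtractf)
  also have "(\<Sum>i\<in>{1..r}. q (Color (inv w3 i))) = (\<Sum>a\<in>{1..r}. q (Color a))"
    by (rule sum.reindex_bij_betw[OF permutes_imp_bij[OF permutes_inv[OF w(1)]]])
  also have "(\<Sum>i\<in>{1..r}. q (Dolor ((inv w4 \<circ> long_element r) i))) = (\<Sum>a\<in>{1..r}. q (Dolor a))"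
    by (rule sum.reindex_bij_betw[OF bij_betw_trans[OF bij_long_element permutes_imp_bij[OF permutes_inv[OF w(2)]]]])
  finally show ?thesis
    using bicol_charge[OF s, of q] empty by simp
qed

section \<open>Reading permutations off the side boundaries\<close>

fun hindex :: "hspin \<Rightarrow> nat" where
  "hindex (Color a) = a"
| "hindex (Dolor a) = a"

text \<open>The inverse appears because row \<open>i\<close> carries the index
  \<open>inv w i\<close>; \<open>permutes\<close> demands the identity outside
  \<open>{1..r}\<close>.\<close>

definition boundary_perm :: "nat \<Rightarrow> (nat \<Rightarrow> hspin) \<Rightarrow> nat \<Rightarrow> nat" where
  "boundary_perm r h = inv (\<lambda>i. if i \<in> {1..r} then hindex (h i) else i)"

text \<open>A surjective self-map of a finite set is bijective, so it suffices that every index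
  occurs. \<open>C\<close> is \<open>Color\<close> for the right boundary and \<open>Dolor\<close>
  for the left one.\<close>

lemma boundary_perm:
  assumes h: "\<And>i. i \<in> {1..r} \<Longrightarrow> \<exists>a\<in>{1..r}. h i = C a" and C: "C = Color \<or> C = Dolor"
    and surj: "\<And>a. a \<in> {1..r} \<Longrightarrow> \<exists>i\<in>{1..r}. h i = C a"
  shows "boundary_perm r h permutes {1..r}"
    and "w permutes {1..r} \<Longrightarrow> boundary_perm r h = w \<longleftrightarrow> (\<forall>i\<in>{1..r}. h i = C (inv w i))"
proof -
  let ?p = "\<lambda>i. if i \<in> {1..r} then hindex (h i) else i"
  have C_index: "hindex (C a) = a" for a using C by auto
  have "?p ` {1..r} = {1..r}"
  proof (intro equalityI subsetI)
    fix a assume "a \<in> ?p ` {1..r}"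
    then obtain i where "i \<in> {1..r}" "a = hindex (h i)" by auto
    then show "a \<in> {1..r}" using h[of i] C_index by auto
  next
    fix a assume "a \<in> {1..r}"
    then obtain i where "i \<in> {1..r}" "h i = C a" using surj by blast
    then show "a \<in> ?p ` {1..r}" using C_index[of a] by (intro image_eqI[of _ _ i]) simp_all
  qed
  moreover from this have "inj_on ?p {1..r}" by (intro eq_card_imp_inj_on) simp_all
  ultimately have p: "?p permutes {1..r}"
    by (intro bij_imp_permutes) (auto simp: bij_betw_def)
  then show "boundary_perm r h permutes {1..r}"
    unfolding boundary_perm_def by (rule permutes_inv)
  assume w: "w permutes {1..r}"
  \<comment> \<open>Equality is tested after inverting both permutations, and then only on
    \<open>{1..r}\<close>, since both fix everything else.\<close>
  have "boundary_perm r h = w \<longleftrightarrow> ?p = inv w"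
  proof
    assume "boundary_perm r h = w"
    then have "inv (inv ?p) = inv w" by (simp only: boundary_perm_def)
    then show "?p = inv w" by (simp only: permutes_inv_inv[OF p])
  next
    assume "?p = inv w"
    then show "boundary_perm r h = w"
      unfolding boundary_perm_def by (simp only: permutes_inv_inv[OF w])
  qed
  also have "\<dots> \<longleftrightarrow> (\<forall>i\<in>{1..r}. hindex (h i) = inv w i)"
    unfolding fun_eq_iff using permutes_not_in[OF permutes_inv[OF w]] by metis
  also have "\<dots> \<longleftrightarrow> (\<forall>i\<in>{1..r}. h i = C (inv w i))"
  proof (intro ball_cong refl)
    fix i assume "i \<in> {1..r}"
    then obtain a where "h i = C a" using h by blast
    then show "hindex (h i) = inv w i \<longleftrightarrow> h i = C (inv w i)"
      using C C_index by auto
  qed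
  finally show "boundary_perm r h = w \<longleftrightarrow> (\<forall>i\<in>{1..r}. h i = C (inv w i))" .
qed

text \<open>The states for the various \<open>w1\<close> and \<open>w2\<close> are the fibres of the
  map that reads the side boundaries off a state with empty lower boundary. Every such state lies in
  some fibre, because conservation of each single color and dolor makes its sides
  permutations.\<close>

lemma sum_Z_bicol:
  assumes w: "w3 permutes {1..r}" "w4 permutes {1..r}" and lam: "\<And>i. i \<in> {1..r} \<Longrightarrow> lam i < N"
  shows "(\<Sum>w1 | w1 permutes {1..r}. \<Sum>w2 | w2 permutes {1..r}. Z_bicol r N t lam w1 w2 w3 w4 z) =
    (\<Sum>s\<in>free_bicol_states r r N (bicol_top r lam w3 w4). state_weight r N (fused_weight r t) z s *
      of_bool ((\<lambda>k\<in>{..<N}. boson_count r (row_of r N (snd s) k)) = (\<lambda>k\<in>{..<N}. 0)))"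
proof -
  let ?F = "free_bicol_states r r N (bicol_top r lam w3 w4)"
  let ?E = "{s \<in> ?F. (\<lambda>k\<in>{..<N}. boson_count r (row_of r N (snd s) k)) = (\<lambda>k\<in>{..<N}. 0)}"
  let ?W = "\<lambda>s. (boundary_perm r (\<lambda>i. fst s (i, 0)), boundary_perm r (\<lambda>i. fst s (i, N)))"
  let ?P = "{w. w permutes {1..r}}"
  have top: "bicol_top r lam w3 w4 k \<in> boson_spins r" for k
    by (simp add: bicol_top_def)
  have fin: "finite ?F"
    unfolding free_bicol_states_def
    by (rule finite_free_states[OF finite_hspins finite_fused_lower_spins top])
  \<comment> \<open>A boson number is a sum of natural numbers, so it vanishes only on an empty
    edge.\<close>
  have E_iff: "s \<in> ?E \<longleftrightarrow> s \<in> ?F \<and> (\<forall>k<N. snd s (r, k) = (\<lambda>p\<in>{1..r} \<times> {1..r}. 0))" for s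
  proof -
    have "boson_count r (row_of r N (snd s) k) = 0 \<longleftrightarrow> snd s (r, k) = (\<lambda>p\<in>{1..r} \<times> {1..r}. 0)"
      if "s \<in> ?F" "k < N" for k
    proof -
      have "snd s (r, k) \<in> boson_spins r"
        using that by (auto simp: free_bicol_states_def free_states_def PiE_iff)
      then show ?thesis
        using \<open>k < N\<close> by (auto simp: boson_count_def row_of_def fun_eq_iff PiE_iff extensional_def)
    qed
    then show ?thesis by (auto simp: fun_eq_iff)
  qed
  have bd: "\<exists>a\<in>{1..r}. fst s (i, 0) = Color a" "\<exists>a\<in>{1..r}. fst s (i, N) = Dolor a"
    if "s \<in> ?F" "i \<in> {1..r}" for s i
  proof -
    have "fst s (i, 0) \<in> {x \<in> hspins r. hsign x = Minus}" "fst s (i, N) \<in> {x \<in> hspins r. hsign x = Plus}"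
      using that by (auto simp: free_bicol_states_def free_states_def)
    then show "\<exists>a\<in>{1..r}. fst s (i, 0) = Color a" "\<exists>a\<in>{1..r}. fst s (i, N) = Dolor a"
      by (auto simp: hspins_def)
  qed
  have charge: "(\<Sum>i\<in>{1..r}. q (fst s (i, 0))) - (\<Sum>i\<in>{1..r}. q (fst s (i, N))) =
      (\<Sum>a\<in>{1..r}. q (Color a)) - (\<Sum>a\<in>{1..r}. q (Dolor a) :: int)" if "s \<in> ?E" for s q
    using bicol_boundary_charge[of "fst s" "snd s" r r N lam w3 w4 q] that w lam E_iff by simp
  have surj: "\<exists>i\<in>{1..r}. fst s (i, 0) = Color a" "\<exists>i\<in>{1..r}. fst s (i, N) = Dolor a"
    if s: "s \<in> ?E" and a: "a \<in> {1..r}" for s a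
  proof -
    have sF: "s \<in> ?F" using s by simp
    \<comment> \<open>No color occurs on the left; were color \<open>a\<close> missing on the right,
      its charge balance would read \<open>0 - 0 = 1 - 0\<close>.\<close>
    show "\<exists>i\<in>{1..r}. fst s (i, 0) = Color a"
    proof (rule ccontr)
      assume "\<not> ?thesis"
      then have "(\<Sum>i\<in>{1..r}. of_bool (fst s (i, 0) = Color a) :: int) = 0" by simp
      moreover have "(\<Sum>i\<in>{1..r}. of_bool (fst s (i, N) = Color a) :: int) = 0"
        using bd(2)[OF sF] by (intro sum.neutral ballI) force
      moreover have "(\<Sum>b\<in>{1..r}. of_bool (Color b = Color a) :: int) = 1"
        using a by (simp add: of_bool_def)
      ultimately show False using charge[OF s, of "\<lambda>x. of_bool (x = Color a)"] by simp
    qed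
    \<comment> \<open>With the roles of the sides exchanged, a missing dolor would give
      \<open>0 - 0 = 0 - 1\<close>.\<close>
    show "\<exists>i\<in>{1..r}. fst s (i, N) = Dolor a"
    proof (rule ccontr)
      assume "\<not> ?thesis"
      then have "(\<Sum>i\<in>{1..r}. of_bool (fst s (i, N) = Dolor a) :: int) = 0" by simp
      moreover have "(\<Sum>i\<in>{1..r}. of_bool (fst s (i, 0) = Dolor a) :: int) = 0"
        using bd(1)[OF sF] by (intro sum.neutral ballI) force
      moreover have "(\<Sum>b\<in>{1..r}. of_bool (Dolor b = Dolor a) :: int) = 1"
        using a by (simp add: of_bool_def)
      ultimately show False using charge[OF s, of "\<lambda>x. of_bool (x = Dolor a)"] by simp
    qed
  qed
  have perm: "boundary_perm r (\<lambda>i. fst s (i, 0)) permutes {1..r}" "boundary_perm r (\<lambda>i. fst s (i, N)) permutes {1..r}"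
    and perm_eq: "w permutes {1..r} \<Longrightarrow> boundary_perm r (\<lambda>i. fst s (i, 0)) = w \<longleftrightarrow> (\<forall>i\<in>{1..r}. fst s (i, 0) = Color (inv w i))"
      "w permutes {1..r} \<Longrightarrow> boundary_perm r (\<lambda>i. fst s (i, N)) = w \<longleftrightarrow> (\<forall>i\<in>{1..r}. fst s (i, N) = Dolor (inv w i))"
    if "s \<in> ?E" for s w
  proof -
    have "s \<in> ?F" using that by simp
    note * = boundary_perm[of r "\<lambda>i. fst s (i, 0)" Color, OF bd(1)[OF this] disjI1[OF refl] surj(1)[OF that]]
      boundary_perm[of r "\<lambda>i. fst s (i, N)" Dolor, OF bd(2)[OF this] disjI2[OF refl] surj(2)[OF that]]
    show "boundary_perm r (\<lambda>i. fst s (i, 0)) permutes {1..r}"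
      by (rule *(1))
    show "boundary_perm r (\<lambda>i. fst s (i, N)) permutes {1..r}"
      by (rule *(3))
    assume w: "w permutes {1..r}"
    show "boundary_perm r (\<lambda>i. fst s (i, 0)) = w \<longleftrightarrow> (\<forall>i\<in>{1..r}. fst s (i, 0) = Color (inv w i))"
      by (rule *(2)[OF _ _ w])
    show "boundary_perm r (\<lambda>i. fst s (i, N)) = w \<longleftrightarrow> (\<forall>i\<in>{1..r}. fst s (i, N) = Dolor (inv w i))"
      by (rule *(4)[OF _ _ w])
  qed
  have states: "bicol_states r N lam w1 w2 w3 w4 = {s \<in> ?E. ?W s = (w1, w2)}"
    if p: "w1 permutes {1..r}" "w2 permutes {1..r}" for w1 w2
  proof -
    have "s \<in> bicol_states r N lam w1 w2 w3 w4 \<longleftrightarrow> s \<in> ?F \<and> (\<forall>k<N. snd s (r, k) = (\<lambda>p\<in>{1..r} \<times> {1..r}. 0)) \<and>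
        (\<forall>i\<in>{1..r}. fst s (i, 0) = Color (inv w1 i)) \<and> (\<forall>i\<in>{1..r}. fst s (i, N) = Dolor (inv w2 i))" for s
    proof -
      have "Color (inv w1 i) \<in> hspins r" "Dolor (inv w2 i) \<in> hspins r" if "i \<in> {1..r}" for i
        using that p permutes_in_image[OF permutes_inv] by (metis Color_in_hspins Dolor_in_hspins)+
      then show ?thesis
        by (cases s) (auto simp: bicol_states_def lattice_states_def free_bicol_states_def free_states_def)
    qed
    note bicol_iff = this
    show ?thesis
    proof (rule set_eqI)
      fix s
      show "s \<in> bicol_states r N lam w1 w2 w3 w4 \<longleftrightarrow> s \<in> {s \<in> ?E. ?W s = (w1, w2)}"
      proof (cases "s \<in> ?E")
        case True
        then have "?W s = (w1, w2) \<longleftrightarrow> (\<forall>i\<in>{1..r}. fst s (i, 0) = Color (inv w1 i)) \<and>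
            (\<forall>i\<in>{1..r}. fst s (i, N) = Dolor (inv w2 i))"
          by (simp only: prod.inject perm_eq[OF True] p)
        with True show ?thesis unfolding bicol_iff using E_iff[of s] by blast
      next
        case False
        then show ?thesis unfolding bicol_iff using E_iff[of s] by blast
      qed
    qed
  qed
  have "(\<Sum>w1 | w1 permutes {1..r}. \<Sum>w2 | w2 permutes {1..r}. Z_bicol r N t lam w1 w2 w3 w4 z) =
      (\<Sum>y\<in>?P \<times> ?P. Z_bicol r N t lam (fst y) (snd y) w3 w4 z)"
    by (simp add: sum.cartesian_product case_prod_beta)
  also have "\<dots> = (\<Sum>y\<in>?P \<times> ?P. \<Sum>s | s \<in> ?E \<and> ?W s = y. state_weight r N (fused_weight r t) z s)"
    by (intro sum.cong refl)
      (auto simp: Z_bicol_def states partition_function_def state_weight_def case_prod_beta)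
  also have "\<dots> = (\<Sum>s\<in>?E. state_weight r N (fused_weight r t) z s)"
    by (rule sum.group) (use fin perm in \<open>auto intro!: finite_cartesian_product finite_permutations\<close>)
  also have "\<dots> = (\<Sum>s\<in>?F. state_weight r N (fused_weight r t) z s *
      of_bool ((\<lambda>k\<in>{..<N}. boson_count r (row_of r N (snd s) k)) = (\<lambda>k\<in>{..<N}. 0)))"
    using fin by (simp add: Int_def)
  finally show ?thesis .
qed

theorem corollary6p4:
  fixes r N :: nat
    and lam :: "nat \<Rightarrow> nat"
    and t :: "'a::field"
    and z :: "nat \<Rightarrow> 'a"
    and w3 w4 :: "nat \<Rightarrow> nat"
  assumes "r \<ge> 1" and "N \<ge> 1"
    and "antimono_on {1..r} lam" and "lam 1 < N"
    and "\<And>i. i \<in> {1..r} \<Longrightarrow> z i \<noteq> 0"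
    and "w3 permutes {1..r}" and "w4 permutes {1..r}"
  shows "Z_uncol r N t lam z =
    (\<Sum>w1 | w1 permutes {1..r}. \<Sum>w2 | w2 permutes {1..r}.
       scaled_Z_bicol r N t lam w1 w2 w3 w4 z)"
proof -
  let ?c = "\<Prod>i\<in>{1..r}. z i powi (int N * (1 - int r))"
  have lam: "lam i < N" if "i \<in> {1..r}" for i
  proof -
    have "lam i \<le> lam 1"
      using monotone_onD[OF assms(3), of 1 i] that \<open>r \<ge> 1\<close> by simp
    then show ?thesis using \<open>lam 1 < N\<close> by simp
  qed
  have "z i powi (int N * (1 - int r)) * z i ^ (N * (r - 1)) = 1" if "i \<in> {1..r}" for i
  proof -
    \<comment> \<open>The scaling exponent is a negated natural number, as \<open>r \<ge> 1\<close>
      keeps \<open>r - 1\<close> from being truncated; the two powers then cancel because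
      \<open>z i \<noteq> 0\<close>.\<close>
    have "int N * (1 - int r) = - int (N * (r - 1))"
      using \<open>r \<ge> 1\<close> by (simp add: of_nat_diff algebra_simps)
    then show ?thesis
      using assms(5)[OF that] by (simp only: power_int_minus power_int_of_nat) simp
  qed
  then have scale: "?c * (\<Prod>i\<in>{1..r}. z i ^ (N * (r - 1))) = 1"
    by (simp flip: prod.distrib)
  have "(\<Sum>w1 | w1 permutes {1..r}. \<Sum>w2 | w2 permutes {1..r}. scaled_Z_bicol r N t lam w1 w2 w3 w4 z) =
      ?c * (\<Sum>w1 | w1 permutes {1..r}. \<Sum>w2 | w2 permutes {1..r}. Z_bicol r N t lam w1 w2 w3 w4 z)"
    by (simp add: scaled_Z_bicol_def sum_distrib_left)
  also have "\<dots> = ?c * ((\<Prod>i\<in>{1..r}. z i ^ (N * (r - 1))) * Z_uncol r N t lam z)"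
  proof -
    have "bicol_top r lam w3 w4 k \<in> boson_spins r" for k
      by (simp add: bicol_top_def)
    \<comment> \<open>The observable is the indicator of an empty lower boundary, expressed in boson
      numbers so that it makes sense in both models.\<close>
    note lump = states_lump[OF \<open>r \<ge> 1\<close> this, where g = "\<lambda>B. of_bool (B = (\<lambda>k\<in>{..<N}. 0))"]
    show ?thesis
      using lam by (simp only: sum_Z_bicol[OF assms(6,7)] lump Z_uncol_free boson_count_bicol_top[OF assms(6,7)])
  qed
  also have "\<dots> = Z_uncol r N t lam z"
    by (simp only: mult.assoc[symmetric] scale mult_1)
  finally show ?thesis by simp
qed

end
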